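(* For every constant $\gamma > 0$, there exists a polynomial-time algorithm that, given a $\delta$-dense Max 2-CSP instance of value $\lambda$, produces an assignment of value $\Omega((\delta \lambda)^{O(1/\gamma)}N^{-\gamma})$ for the instance.
   Context: An instance $(q, V, E, \{C_e\}_{e \in E})$ of Max 2-CSP consists of a simple undirected graph $(V,E)$ and, for each edge $e=(u,v)\in E$, a constraint $C_e:[q]^2\to\{0,1\}$; the goal is to find an assignment $\varphi: V\to[q]$ maximizing the number of satisfied constraints. The value of an assignment is the fraction of edges it satisfies, and the value of an instance is the value of an optimal assignment. A graph $(V,E)$ has density $|E|/|V|^2$, and an instance is $\delta$-dense if its graph is $\delta$-dense. Here $n=|V|$ and $N=nq$. *)

theory Defs
  imports Complex_Main "HOL-Library.FuncSet" "HOL-Computational_Algebra.Polynomial"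
begin

section \<open>Max 2-CSP\<close>

text \<open>
  The vertex set is \<open>{..<num_vertices I}\<close> and the alphabet \<open>[q]\<close> is \<open>{..<alphabet I}\<close>.
  Each undirected edge is represented by exactly one ordered pair \<open>(u, v)\<close>, in either
  orientation; the orientation says which endpoint supplies which argument of the constraint.
\<close>

record csp =
  alphabet :: nat
  num_vertices :: nat
  edges :: "(nat \<times> nat) set"
  constraint :: "nat \<times> nat \<Rightarrow> nat \<Rightarrow> nat \<Rightarrow> bool"

definition max_2csp :: "csp \<Rightarrow> bool" where
  "max_2csp I \<longleftrightarrow> 0 < alphabet I \<and> 0 < num_vertices I \<and>
    (\<forall>(u, v) \<in> edges I. u < num_vertices I \<and> v < num_vertices I \<and> u \<noteq> v \<and> (v, u) \<notin> edges I)"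

definition assignments :: "csp \<Rightarrow> (nat \<Rightarrow> nat) set" where
  "assignments I = {..<num_vertices I} \<rightarrow>\<^sub>E {..<alphabet I}"

text \<open>On an instance without edges every assignment has value \<open>0 / 0 = 0\<close>.\<close>

definition assignment_value :: "csp \<Rightarrow> (nat \<Rightarrow> nat) \<Rightarrow> real" where
  "assignment_value I \<phi> =
    real (card {(u, v) \<in> edges I. constraint I (u, v) (\<phi> u) (\<phi> v)}) / real (card (edges I))"

definition csp_value :: "csp \<Rightarrow> real" where
  "csp_value I = Max (assignment_value I ` assignments I)"

definition density :: "csp \<Rightarrow> real" where
  "density I = real (card (edges I)) / real (num_vertices I) ^ 2"


section \<open>Polynomial-time algorithms\<close>

text \<open>
  Algorithms are programs of the language WHILE of Jones (Computability and Complexity from a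
  Programming Perspective, 1997): imperative programs over binary trees. An operation on trees
  takes unit time, since \<open>Node\<close> allocates one cell and shares its arguments. The problems
  decidable in polynomial time by WHILE programs are those decidable in polynomial time by
  Turing machines. As in Jones, selecting a child of a leaf gives a leaf, and a test is false
  exactly on a leaf.
\<close>

datatype tree = Leaf | Node tree tree

datatype expr = Var nat | LeafE | NodeE expr expr | LeftE expr | RightE expr

datatype com =
    Skip
  | Assign nat expr
  | Seq com com
  | Cond expr com com
  | While expr com

type_synonym state = "nat \<Rightarrow> tree"

primrec left :: "tree \<Rightarrow> tree" where
  "left Leaf = Leaf"
| "left (Node x y) = x"

primrec right :: "tree \<Rightarrow> tree" where
  "right Leaf = Leaf"
| "right (Node x y) = y"

primrec eval_expr :: "expr \<Rightarrow> state \<Rightarrow> tree" where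
  "eval_expr (Var i) s = s i"
| "eval_expr LeafE s = Leaf"
| "eval_expr (NodeE a b) s = Node (eval_expr a s) (eval_expr b s)"
| "eval_expr (LeftE a) s = left (eval_expr a s)"
| "eval_expr (RightE a) s = right (eval_expr a s)"

primrec cost :: "expr \<Rightarrow> nat" where
  "cost (Var i) = 1"
| "cost LeafE = 1"
| "cost (NodeE a b) = cost a + cost b + 1"
| "cost (LeftE a) = cost a + 1"
| "cost (RightE a) = cost a + 1"

text \<open>\<open>exec c s t s'\<close>: started in state \<open>s\<close>, program \<open>c\<close> halts after time \<open>t\<close> in state \<open>s'\<close>.\<close>

inductive exec :: "com \<Rightarrow> state \<Rightarrow> nat \<Rightarrow> state \<Rightarrow> bool" where
  Skip: "exec Skip s 1 s"
| Assign: "exec (Assign i a) s (cost a + 1) (s(i := eval_expr a s))"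
| Seq: "exec c s t s' \<Longrightarrow> exec d s' u s'' \<Longrightarrow> exec (Seq c d) s (t + u) s''"
| CondTrue: "eval_expr b s \<noteq> Leaf \<Longrightarrow> exec c s t s' \<Longrightarrow> exec (Cond b c d) s (cost b + 1 + t) s'"
| CondFalse: "eval_expr b s = Leaf \<Longrightarrow> exec d s t s' \<Longrightarrow> exec (Cond b c d) s (cost b + 1 + t) s'"
| WhileTrue: "eval_expr b s \<noteq> Leaf \<Longrightarrow> exec c s t s' \<Longrightarrow> exec (While b c) s' u s'' \<Longrightarrow>
    exec (While b c) s (cost b + 1 + t + u) s''"
| WhileFalse: "eval_expr b s = Leaf \<Longrightarrow> exec (While b c) s (cost b + 1) s"

text \<open>Variable \<open>0\<close> holds the input and the output; all other variables start as leaves.\<close>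

definition computes :: "com \<Rightarrow> tree \<Rightarrow> nat \<Rightarrow> tree \<Rightarrow> bool" where
  "computes c x t y \<longleftrightarrow> (\<exists>s. exec c ((\<lambda>_. Leaf)(0 := x)) t s \<and> s 0 = y)"

text \<open>The size of a tree is its number of inner nodes.\<close>

definition polynomial_time_on :: "tree set \<Rightarrow> com \<Rightarrow> bool" where
  "polynomial_time_on X c \<longleftrightarrow>
    (\<exists>p :: nat poly. \<forall>x \<in> X. \<exists>t y. computes c x t y \<and> t \<le> poly p (size x))"


section \<open>Encoding of instances and assignments\<close>

primrec encode_nat :: "nat \<Rightarrow> tree" where
  "encode_nat 0 = Leaf"
| "encode_nat (Suc n) = Node Leaf (encode_nat n)"

primrec encode_list :: "('a \<Rightarrow> tree) \<Rightarrow> 'a list \<Rightarrow> tree" where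
  "encode_list f [] = Leaf"
| "encode_list f (x # xs) = Node (f x) (encode_list f xs)"

definition encode_bool :: "bool \<Rightarrow> tree" where
  "encode_bool b = (if b then Node Leaf Leaf else Leaf)"

text \<open>
  An instance is given by \<open>q\<close> and \<open>n\<close> in unary and the \<open>n \<times> n\<close> matrix whose entry at
  \<open>(u, v)\<close> is the \<open>q \<times> q\<close> truth table of the constraint if \<open>(u, v)\<close> is an edge, and a leaf
  otherwise (a truth table is never a leaf, as \<open>q > 0\<close>). The size of the encoding lies between
  \<open>n + q\<close> and a polynomial in \<open>N = n q\<close>.
\<close>

definition encode_table :: "csp \<Rightarrow> nat \<times> nat \<Rightarrow> tree" where
  "encode_table I e =
    encode_list (\<lambda>a. encode_list (\<lambda>b. encode_bool (constraint I e a b)) [0..<alphabet I])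
      [0..<alphabet I]"

definition encode_csp :: "csp \<Rightarrow> tree" where
  "encode_csp I =
    Node (encode_nat (alphabet I)) (Node (encode_nat (num_vertices I))
      (encode_list (\<lambda>u. encode_list (\<lambda>v. if (u, v) \<in> edges I then encode_table I (u, v) else Leaf)
          [0..<num_vertices I])
        [0..<num_vertices I]))"

definition encode_assignment :: "csp \<Rightarrow> (nat \<Rightarrow> nat) \<Rightarrow> tree" where
  "encode_assignment I \<phi> = encode_list (\<lambda>v. encode_nat (\<phi> v)) [0..<num_vertices I]"

definition produces :: "com \<Rightarrow> csp \<Rightarrow> (nat \<Rightarrow> nat) \<Rightarrow> bool" where
  "produces c I \<phi> \<longleftrightarrow> \<phi> \<in> assignments I \<and> (\<exists>t. computes c (encode_csp I) t (encode_assignment I \<phi>))"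

end

theory Submission
  imports Defs
begin

text \<open>
  Let \<open>L\<^sub>t(v)\<close> be the set of labels of \<open>v\<close> compatible with all nodes \<open>(u, a)\<close> of a tuple \<open>t\<close>. Fix an
  optimal assignment \<open>\<psi>\<close> and take tuples of nodes \<open>(u, \<psi> u)\<close>. Extending \<open>t\<close> one node at a time, \<open>k\<close>
  times, the size of \<open>L\<^sub>t(v)\<close> falls from \<open>q\<close> to no less than \<open>1\<close> as long as \<open>\<psi> v\<close> remains compatible,
  so in some step it is multiplied by at least about \<open>q powr (-1/k)\<close>. As at least
  \<open>(\<delta> \<lambda> n) ^ (k + 1)\<close> pairs of a \<open>k\<close>-tuple and a vertex are compatible, there is a \<open>t\<close> of fewer than
  \<open>k\<close> nodes such that for many pairs \<open>(u, v)\<close> a large fraction of \<open>L\<^sub>t(v)\<close> is compatible with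
  \<open>(u, \<psi> u)\<close>. The algorithm tries all \<open>t\<close>. For each it lets \<open>\<alpha> u\<close> be the label compatible with
  most of a random choice from the lists \<open>L\<^sub>t\<close>, lets \<open>\<beta>\<close> be a best response to \<open>\<alpha>\<close>, and
  derandomizes the uniform choice between \<open>\<alpha> v\<close> and \<open>\<beta> v\<close> at every vertex.
\<close>

section \<open>Closure properties of polynomial time\<close>

text \<open>Only the labels of \<psi> on the vertices of t are guessed, so there are polynomially
  many trials for fixed \<open>k = nat \<lceil>1 / \<gamma>\<rceil>\<close>. Elsewhere \<psi> enters
  by comparison alone: against a random choice from the lists, \<alpha> u does at least as well as
  \<psi> u, and against \<alpha>, \<beta> v does at least as well as an average label of the list of
  v. The lost fraction is thus paid at one end of a pair only. Now \<alpha> u and \<beta> v suit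
  many ordered pairs (u, v), but a vertex occurs at both ends and gets a single label; the random
  choice gives a pair the wanted combination with probability 1/4. The constants in the theorem must
  not depend on \<gamma>. Averaging over k steps costs a factor 1/k, which is absorbed by k further
  powers of \<delta>\<lambda> \<le> 1/2. For \<gamma> > 2 the exponent \<open>8 / \<gamma>\<close>
  can be too small for this argument, but there any assignment that satisfies an edge is good
  enough. No program is written for the algorithm as a whole: its running time follows from closure
  properties of a class of functions.\<close>

definition poly_bounded :: "(nat \<Rightarrow> nat) \<Rightarrow> bool" where
  "poly_bounded f \<longleftrightarrow> (\<exists>k. \<forall>n. f n \<le> (n + 2) ^ k)"

lemma poly_bounded_mono: "poly_bounded g \<Longrightarrow> (\<And>n. f n \<le> g n) \<Longrightarrow> poly_bounded f"
  unfolding poly_bounded_def using le_trans by blast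

lemma poly_bounded_power: "poly_bounded (\<lambda>n. (n + 2) ^ k)"
  unfolding poly_bounded_def by blast

lemma poly_bounded_id: "poly_bounded (\<lambda>n. n)"
  unfolding poly_bounded_def by (rule exI[of _ 1]) simp

text \<open>The base \<open>n + 2\<close> is at least 2 even at n = 0, so a large enough exponent
  absorbs any constant.\<close>

lemma poly_bounded_const: "poly_bounded (\<lambda>_. c)"
proof -
  have "c \<le> (n + 2) ^ c" for n :: nat
  proof -
    have "c \<le> 2 ^ c" by (simp add: less_imp_le)
    also have "\<dots> \<le> (n + 2) ^ c" by (intro power_mono) auto
    finally show ?thesis .
  qed
  then show ?thesis unfolding poly_bounded_def by blast
qed

lemma poly_bounded_mult:
  assumes "poly_bounded f" "poly_bounded g"
  shows "poly_bounded (\<lambda>n. f n * g n)"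
proof -
  obtain k l where "\<And>n. f n \<le> (n + 2) ^ k" "\<And>n. g n \<le> (n + 2) ^ l"
    using assms unfolding poly_bounded_def by blast
  then have "f n * g n \<le> (n + 2) ^ (k + l)" for n
    by (simp add: power_add mult_mono)
  then show ?thesis unfolding poly_bounded_def by blast
qed

lemma poly_bounded_add:
  assumes "poly_bounded f" "poly_bounded g"
  shows "poly_bounded (\<lambda>n. f n + g n)"
proof -
  have "poly_bounded (\<lambda>n. (f n + 1) * (g n + 1))" if
    "poly_bounded (\<lambda>n. f n + 1)" "poly_bounded (\<lambda>n. g n + 1)"
    using that by (rule poly_bounded_mult)
  moreover have "poly_bounded (\<lambda>n. h n + 1)" if h: "poly_bounded h" for h
  proof -
    obtain k where k: "\<And>n. h n \<le> (n + 2) ^ k" using h unfolding poly_bounded_def by blast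
    have "h n + 1 \<le> (n + 2) ^ Suc k" for n
    proof -
      have "h n + 1 \<le> (n + 2) ^ k + (n + 2) ^ k"
        using k[of n] by (intro add_mono) auto
      also have "\<dots> \<le> (n + 2) ^ Suc k" by simp
      finally show ?thesis .
    qed
    then show ?thesis unfolding poly_bounded_def by blast
  qed
  ultimately have "poly_bounded (\<lambda>n. (f n + 1) * (g n + 1))" using assms by blast
  then show ?thesis by (rule poly_bounded_mono) simp
qed

lemma poly_bounded_exp:
  assumes "poly_bounded f"
  shows "poly_bounded (\<lambda>n. f n ^ k)"
proof (induction k)
  case 0
  show ?case using poly_bounded_const[of 1] by simp
next
  case (Suc k)
  show ?case using poly_bounded_mult[OF assms Suc] by simp
qed

lemmas poly_bounded_intros =
  poly_bounded_add poly_bounded_mult poly_bounded_exp poly_bounded_id poly_bounded_const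

text \<open>
  A variable of index at least \<open>m\<close> survives the program, so a caller can keep its own data there;
  the contents of the other variables apart from \<open>0\<close> are irrelevant.
\<close>

definition ptime :: "('a \<Rightarrow> tree) \<Rightarrow> ('a \<Rightarrow> tree) \<Rightarrow> bool" where
  "ptime E F \<longleftrightarrow> (\<exists>c m k. \<forall>a s. s 0 = E a \<longrightarrow>
    (\<exists>t s'. exec c s t s' \<and> s' 0 = F a \<and> (\<forall>j\<ge>m. s' j = s j) \<and>
      t \<le> (size (E a) + 2) ^ k \<and> size (F a) \<le> (size (E a) + 2) ^ k))"

lemma ptimeI:
  assumes "\<And>a s. s 0 = E a \<Longrightarrow> \<exists>t s'. exec c s t s' \<and> s' 0 = F a \<and> (\<forall>j\<ge>m. s' j = s j) \<and>
      t \<le> f (size (E a)) \<and> size (F a) \<le> g (size (E a))"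
    and "poly_bounded f" "poly_bounded g"
  shows "ptime E F"
proof -
  have "poly_bounded (\<lambda>n. f n + g n)" using assms(2,3) by (rule poly_bounded_add)
  then obtain k where k: "\<And>n. f n + g n \<le> (n + 2) ^ k" unfolding poly_bounded_def by blast
  have "\<exists>t s'. exec c s t s' \<and> s' 0 = F a \<and> (\<forall>j\<ge>m. s' j = s j) \<and>
      t \<le> (size (E a) + 2) ^ k \<and> size (F a) \<le> (size (E a) + 2) ^ k" if "s 0 = E a" for a s
    using assms(1)[of s a, OF that] k[of "size (E a)"] by fastforce
  then show ?thesis unfolding ptime_def by blast
qed

lemma ptimeE:
  assumes "ptime E F"
  obtains c m k where "\<And>a s. s 0 = E a \<Longrightarrow>
    \<exists>t s'. exec c s t s' \<and> s' 0 = F a \<and> (\<forall>j\<ge>m. s' j = s j) \<and> t \<le> (size (E a) + 2) ^ k"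
    "\<And>a. size (F a) \<le> (size (E a) + 2) ^ k"
proof -
  obtain c m k where *: "\<And>a s. s 0 = E a \<Longrightarrow>
    \<exists>t s'. exec c s t s' \<and> s' 0 = F a \<and> (\<forall>j\<ge>m. s' j = s j) \<and>
      t \<le> (size (E a) + 2) ^ k \<and> size (F a) \<le> (size (E a) + 2) ^ k"
    using assms unfolding ptime_def by blast
  have "size (F a) \<le> (size (E a) + 2) ^ k" for a
    using *[of "\<lambda>_. E a" a] by auto
  then show thesis using that[of c m k] * by blast
qed

lemma ptime_size:
  assumes "ptime E F"
  obtains k where "\<And>a. size (F a) \<le> (size (E a) + 2) ^ k"
  using assms by (rule ptimeE) blast

section \<open>Sequencing, tree operations and tests\<close>

lemma exec_Assign: "t = cost e + 1 \<Longrightarrow> s' = s(i := eval_expr e s) \<Longrightarrow> exec (Assign i e) s t s'"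
  by (simp add: exec.Assign del: One_nat_def add_Suc_right)

text \<open>The intermediate value \<open>f a\<close> may have another type with its own encoding.
  The second program relies on variable \<open>0\<close> only, so what the first one leaves in other
  variables does no harm.\<close>

lemma ptime_comp:
  assumes "ptime E (\<lambda>a. E' (f a))" "ptime E' G"
  shows "ptime E (\<lambda>a. G (f a))"
proof -
  obtain c1 m1 k1 where c1: "\<And>a s. s 0 = E a \<Longrightarrow>
    \<exists>t s'. exec c1 s t s' \<and> s' 0 = E' (f a) \<and> (\<forall>j\<ge>m1. s' j = s j) \<and> t \<le> (size (E a) + 2) ^ k1"
    and k1: "\<And>a. size (E' (f a)) \<le> (size (E a) + 2) ^ k1"
    using assms(1) by (rule ptimeE) blast
  obtain c2 m2 k2 where c2: "\<And>a s. s 0 = E' a \<Longrightarrow>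
    \<exists>t s'. exec c2 s t s' \<and> s' 0 = G a \<and> (\<forall>j\<ge>m2. s' j = s j) \<and> t \<le> (size (E' a) + 2) ^ k2"
    and k2: "\<And>a. size (G a) \<le> (size (E' a) + 2) ^ k2"
    using assms(2) by (rule ptimeE) blast
  have k12: "(size (E' (f a)) + 2) ^ k2 \<le> ((size (E a) + 2) ^ k1 + 2) ^ k2" for a
    using k1[of a] by (intro power_mono) auto
  show ?thesis
  proof (rule ptimeI)
    fix a and s :: state assume "s 0 = E a"
    then obtain t1 s1 where 1: "exec c1 s t1 s1" "s1 0 = E' (f a)" "\<forall>j\<ge>m1. s1 j = s j"
      "t1 \<le> (size (E a) + 2) ^ k1" using c1 by blast
    obtain t2 s2 where 2: "exec c2 s1 t2 s2" "s2 0 = G (f a)" "\<forall>j\<ge>m2. s2 j = s1 j"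
      "t2 \<le> (size (E' (f a)) + 2) ^ k2" using c2[of s1 "f a", OF 1(2)] by blast
    have "exec (Seq c1 c2) s (t1 + t2) s2" using 1 2 by (blast intro: exec.Seq)
    moreover have "\<forall>j\<ge>max m1 m2. s2 j = s j" using 1 2 by auto
    ultimately show "\<exists>t s'. exec (Seq c1 c2) s t s' \<and> s' 0 = G (f a) \<and>
        (\<forall>j\<ge>max m1 m2. s' j = s j) \<and>
        t \<le> (\<lambda>n. (n + 2) ^ k1 + ((n + 2) ^ k1 + 2) ^ k2) (size (E a)) \<and>
        size (G (f a)) \<le> (\<lambda>n. ((n + 2) ^ k1 + 2) ^ k2) (size (E a))"
      using 1 2 k12[of a] k2[of "f a"] by (intro exI[of _ "t1 + t2"] exI[of _ s2]) auto
  qed (intro poly_bounded_intros)+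
qed

lemma ptime_refl: "ptime E E"
  by (rule ptimeI[where c=Skip and m="0" and f="\<lambda>_. 1" and g="\<lambda>n. n"])
    (auto intro!: poly_bounded_intros exI exec.Skip)

lemma ptime_left:
  assumes "ptime E F"
  shows "ptime E (\<lambda>a. left (F a))"
proof -
  have [simp]: "size (left t) \<le> size t" for t by (cases t) auto
  have "ptime (\<lambda>t. t) left"
    by (rule ptimeI[where c="Assign 0 (LeftE (Var 0))" and m=1 and f="\<lambda>_. 3" and g="\<lambda>n. n"])
      (auto intro!: poly_bounded_intros exI exec_Assign)
  then show ?thesis using ptime_comp[of E "\<lambda>t. t" F left] assms by simp
qed

lemma ptime_right:
  assumes "ptime E F"
  shows "ptime E (\<lambda>a. right (F a))"
proof -
  have [simp]: "size (right t) \<le> size t" for t by (cases t) auto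
  have "ptime (\<lambda>t. t) right"
    by (rule ptimeI[where c="Assign 0 (RightE (Var 0))" and m=1 and f="\<lambda>_. 3" and g="\<lambda>n. n"])
      (auto intro!: poly_bounded_intros exI exec_Assign)
  then show ?thesis using ptime_comp[of E "\<lambda>t. t" F right] assms by simp
qed

lemma ptime_Leaf: "ptime E (\<lambda>_. Leaf)"
  by (rule ptimeI[where c="Assign 0 LeafE" and m=1 and f="\<lambda>_. 2" and g="\<lambda>n. n"])
    (auto intro!: poly_bounded_intros exI exec_Assign)

lemma ptime_Node:
  assumes "ptime E F" "ptime E G"
  shows "ptime E (\<lambda>a. Node (F a) (G a))"
proof -
  obtain c1 m1 k1 where c1: "\<And>a s. s 0 = E a \<Longrightarrow>
    \<exists>t s'. exec c1 s t s' \<and> s' 0 = F a \<and> (\<forall>j\<ge>m1. s' j = s j) \<and> t \<le> (size (E a) + 2) ^ k1"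
    and k1: "\<And>a. size (F a) \<le> (size (E a) + 2) ^ k1"
    using assms(1) by (rule ptimeE) blast
  obtain c2 m2 k2 where c2: "\<And>a s. s 0 = E a \<Longrightarrow>
    \<exists>t s'. exec c2 s t s' \<and> s' 0 = G a \<and> (\<forall>j\<ge>m2. s' j = s j) \<and> t \<le> (size (E a) + 2) ^ k2"
    and k2: "\<And>a. size (G a) \<le> (size (E a) + 2) ^ k2"
    using assms(2) by (rule ptimeE) blast
  \<comment> \<open>Neither \<open>c1\<close> nor \<open>c2\<close> changes a variable from
    \<open>M\<close> on: \<open>M\<close> keeps the input for \<open>c2\<close>, and
    \<open>Suc M\<close> keeps the result of \<open>c1\<close>. The \<open>Suc\<close> separates
    \<open>M\<close> from variable \<open>0\<close>.\<close>
  define M where "M = Suc (max m1 m2)"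
  have M: "M > 0" "m1 \<le> M" "m2 \<le> M" "m1 \<le> Suc M" "m2 \<le> Suc M" by (auto simp: M_def)
  define c where "c = Seq (Assign M (Var 0)) (Seq c1 (Seq (Assign (Suc M) (Var 0))
    (Seq (Assign 0 (Var M)) (Seq c2 (Assign 0 (NodeE (Var (Suc M)) (Var 0)))))))"
  show ?thesis
  proof (rule ptimeI)
    fix a and s :: state assume s: "s 0 = E a"
    define s1 where "s1 = s(M := E a)"
    have "s1 0 = E a" using s M by (simp add: s1_def)
    then obtain t1 s2 where 1: "exec c1 s1 t1 s2" "s2 0 = F a" "\<forall>j\<ge>m1. s2 j = s1 j"
      "t1 \<le> (size (E a) + 2) ^ k1" using c1 by blast
    define s3 where "s3 = s2(Suc M := F a)"
    define s4 where "s4 = s3(0 := E a)"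
    have "s4 0 = E a" by (simp add: s4_def)
    then obtain t2 s5 where 2: "exec c2 s4 t2 s5" "s5 0 = G a" "\<forall>j\<ge>m2. s5 j = s4 j"
      "t2 \<le> (size (E a) + 2) ^ k2" using c2 by blast
    define s6 where "s6 = s5(0 := Node (F a) (G a))"
    have "exec c s (2 + (t1 + (2 + (2 + (t2 + 4))))) s6"
      unfolding c_def
    proof (intro exec.Seq)
      show "exec (Assign M (Var 0)) s 2 s1" by (rule exec_Assign) (auto simp: s1_def s)
      show "exec c1 s1 t1 s2" by fact
      show "exec (Assign (Suc M) (Var 0)) s2 2 s3" by (rule exec_Assign) (auto simp: s3_def 1)
      show "exec (Assign 0 (Var M)) s3 2 s4"
        using 1(3) M by (intro exec_Assign) (auto simp: s4_def s3_def s1_def)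
      show "exec c2 s4 t2 s5" by fact
      show "exec (Assign 0 (NodeE (Var (Suc M)) (Var 0))) s5 4 s6"
        using 2 M by (intro exec_Assign) (auto simp: s6_def s4_def s3_def)
    qed
    moreover have "\<forall>j\<ge>M + 2. s6 j = s j"
      using 1 2 M by (auto simp: s6_def s4_def s3_def s1_def)
    moreover have "s6 0 = Node (F a) (G a)" by (simp add: s6_def)
    ultimately show "\<exists>t s'. exec c s t s' \<and> s' 0 = Node (F a) (G a) \<and>
        (\<forall>j\<ge>M + 2. s' j = s j) \<and>
        t \<le> (\<lambda>n. 10 + (n + 2) ^ k1 + (n + 2) ^ k2) (size (E a)) \<and>
        size (Node (F a) (G a)) \<le> (\<lambda>n. 1 + (n + 2) ^ k1 + (n + 2) ^ k2) (size (E a))"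
      using 1(4) 2(4) k1[of a] k2[of a] by (intro exI conjI) auto
  qed (intro poly_bounded_intros)+
qed

lemma ptime_if_Leaf:
  assumes "ptime E B" "ptime E F" "ptime E G"
  shows "ptime E (\<lambda>a. if B a = Leaf then G a else F a)"
proof -
  \<comment> \<open>Pairing the test with the input keeps the input available to the chosen branch
    without reserving a variable.\<close>
  obtain c0 m0 k0 where c0: "\<And>a s. s 0 = E a \<Longrightarrow>
    \<exists>t s'. exec c0 s t s' \<and> s' 0 = Node (B a) (E a) \<and> (\<forall>j\<ge>m0. s' j = s j) \<and>
      t \<le> (size (E a) + 2) ^ k0"
    using ptime_Node[OF assms(1) ptime_refl] by (rule ptimeE) blast
  obtain c1 m1 k1 where c1: "\<And>a s. s 0 = E a \<Longrightarrow>
    \<exists>t s'. exec c1 s t s' \<and> s' 0 = F a \<and> (\<forall>j\<ge>m1. s' j = s j) \<and> t \<le> (size (E a) + 2) ^ k1"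
    and k1: "\<And>a. size (F a) \<le> (size (E a) + 2) ^ k1"
    using assms(2) by (rule ptimeE) blast
  obtain c2 m2 k2 where c2: "\<And>a s. s 0 = E a \<Longrightarrow>
    \<exists>t s'. exec c2 s t s' \<and> s' 0 = G a \<and> (\<forall>j\<ge>m2. s' j = s j) \<and> t \<le> (size (E a) + 2) ^ k2"
    and k2: "\<And>a. size (G a) \<le> (size (E a) + 2) ^ k2"
    using assms(3) by (rule ptimeE) blast
  define p where "p = Assign 0 (RightE (Var 0))"
  define c where "c = Seq c0 (Cond (LeftE (Var 0)) (Seq p c1) (Seq p c2))"
  define M where "M = Suc (max m0 (max m1 m2))"
  show ?thesis
  proof (rule ptimeI)
    fix a and s :: state assume "s 0 = E a"
    then obtain t0 s0 where 0: "exec c0 s t0 s0" "s0 0 = Node (B a) (E a)" "\<forall>j\<ge>m0. s0 j = s j"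
      "t0 \<le> (size (E a) + 2) ^ k0" using c0 by blast
    define s1 where "s1 = s0(0 := E a)"
    have s1: "s1 0 = E a" by (simp add: s1_def)
    have p: "exec p s0 3 s1" unfolding p_def s1_def using 0 by (intro exec_Assign) auto
    obtain t1 s2 where 1: "exec c1 s1 t1 s2" "s2 0 = F a" "\<forall>j\<ge>m1. s2 j = s1 j"
      "t1 \<le> (size (E a) + 2) ^ k1" using c1[of s1 a, OF s1] by blast
    obtain t2 s3 where 2: "exec c2 s1 t2 s3" "s3 0 = G a" "\<forall>j\<ge>m2. s3 j = s1 j"
      "t2 \<le> (size (E a) + 2) ^ k2" using c2[of s1 a, OF s1] by blast
    let ?t = "\<lambda>t. t0 + (cost (LeftE (Var 0)) + 1 + (3 + t))"
    let ?b = "B a = Leaf"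
    have "exec c s (if ?b then ?t t2 else ?t t1) (if ?b then s3 else s2)"
    proof (cases ?b)
      case True
      have "exec (Cond (LeftE (Var 0)) (Seq p c1) (Seq p c2)) s0
          (cost (LeftE (Var 0)) + 1 + (3 + t2)) s3"
        using True 0 p 2 by (intro exec.CondFalse exec.Seq) auto
      then show ?thesis using 0 True unfolding c_def by (auto intro: exec.Seq)
    next
      case False
      have "exec (Cond (LeftE (Var 0)) (Seq p c1) (Seq p c2)) s0
          (cost (LeftE (Var 0)) + 1 + (3 + t1)) s2"
        using False 0 p 1 by (intro exec.CondTrue exec.Seq) auto
      then show ?thesis using 0 False unfolding c_def by (auto intro: exec.Seq)
    qed
    moreover have "\<forall>j\<ge>M. (if ?b then s3 else s2) j = s j"
      using 0 1 2 by (auto simp: s1_def M_def)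
    ultimately show "\<exists>t s'. exec c s t s' \<and> s' 0 = (if ?b then G a else F a) \<and>
        (\<forall>j\<ge>M. s' j = s j) \<and>
        t \<le> (\<lambda>n. (n + 2) ^ k0 + (n + 2) ^ k1 + (n + 2) ^ k2 + 6) (size (E a)) \<and>
        size (if ?b then G a else F a) \<le> (\<lambda>n. (n + 2) ^ k1 + (n + 2) ^ k2) (size (E a))"
      using 0(4) 1(2,4) 2(2,4) k1[of a] k2[of a] by (intro exI conjI) auto
  qed (intro poly_bounded_intros)+
qed

section \<open>Pairs, environments and loops\<close>

definition encode_pair :: "('a \<Rightarrow> tree) \<Rightarrow> ('b \<Rightarrow> tree) \<Rightarrow> 'a \<times> 'b \<Rightarrow> tree" where
  "encode_pair e f z = Node (e (fst z)) (f (snd z))"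

lemma ptime_fst:
  assumes "ptime E (\<lambda>a. encode_pair e f (F a))"
  shows "ptime E (\<lambda>a. e (fst (F a)))"
  using ptime_left[OF assms] by (simp add: encode_pair_def)

lemma ptime_snd:
  assumes "ptime E (\<lambda>a. encode_pair e f (F a))"
  shows "ptime E (\<lambda>a. f (snd (F a)))"
  using ptime_right[OF assms] by (simp add: encode_pair_def)

lemma ptime_Pair:
  assumes "ptime E (\<lambda>a. e (F a))" "ptime E (\<lambda>a. f (G a))"
  shows "ptime E (\<lambda>a. encode_pair e f (F a, G a))"
  using ptime_Node[OF assms] by (simp add: encode_pair_def)

lemma ptime_var: "ptime (encode_pair E e) (\<lambda>w. e (snd w))"
  using ptime_snd[OF ptime_refl[of "encode_pair E e"]] .

lemma ptime_env: "ptime (encode_pair E e) (\<lambda>w. E (fst w))"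
  using ptime_fst[OF ptime_refl[of "encode_pair E e"]] .

text \<open>\<open>encode_pair E e\<close> acts as the environment \<open>E\<close> extended by one
  bound variable. Functions with local variables are treated as with de Bruijn indices:
  \<open>snd\<close> is the innermost variable, and each \<open>fst\<close> steps out of one
  binder.\<close>

lemma ptime_weaken:
  assumes "ptime E F"
  shows "ptime (encode_pair E e) (\<lambda>w. F (fst w))"
  using ptime_comp[OF ptime_env assms] .

lemma size_encode_list: "size (encode_list e xs) = (\<Sum>x\<leftarrow>xs. Suc (size (e x)))"
  by (induction xs) auto

lemma size_encode_nat [simp]: "size (encode_nat n) = n"
  by (induction n) auto

lemma size_encode_list_elem: "x \<in> set xs \<Longrightarrow> size (e x) < size (encode_list e xs)"
  by (induction xs) auto

lemma length_le_size_encode_list: "length xs \<le> size (encode_list e xs)"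
  by (induction xs) auto

lemma size_encode_list_le:
  assumes "\<And>x. x \<in> set xs \<Longrightarrow> size (e x) \<le> b"
  shows "size (encode_list e xs) \<le> length xs * Suc b"
  using assms by (induction xs) fastforce+

text \<open>The source of all iteration. A polynomial-time step can double the accumulator in every
  round, so a size bound is demanded for every prefix of the list and not just for the
  result.\<close>

lemma ptime_fold:
  assumes xs: "ptime E (\<lambda>a. encode_list e (xs a))"
    and init: "ptime E (\<lambda>a. f (init a))"
    and step: "ptime (encode_pair (encode_pair E e) f)
      (\<lambda>w. f (step (fst (fst w)) (snd (fst w)) (snd w)))"
    and bound: "\<And>a ys zs. xs a = ys @ zs \<Longrightarrow> size (f (fold (step a) ys (init a))) \<le> b (size (E a))"
    and b: "poly_bounded b"
  shows "ptime E (\<lambda>a. f (fold (step a) (xs a) (init a)))"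
proof -
  obtain c0 m0 k0 where c0: "\<And>a s. s 0 = E a \<Longrightarrow>
    \<exists>t s'. exec c0 s t s' \<and> s' 0 = Node (E a) (Node (encode_list e (xs a)) (f (init a))) \<and>
      (\<forall>j\<ge>m0. s' j = s j) \<and> t \<le> (size (E a) + 2) ^ k0"
    and k0: "\<And>a. size (Node (E a) (Node (encode_list e (xs a)) (f (init a)))) \<le>
      (size (E a) + 2) ^ k0"
    using ptime_Node[OF ptime_refl ptime_Node[OF xs init]] by (rule ptimeE) blast
  obtain c1 m1 k1 where c1: "\<And>w s. s 0 = encode_pair (encode_pair E e) f w \<Longrightarrow>
    \<exists>t s'. exec c1 s t s' \<and> s' 0 = f (step (fst (fst w)) (snd (fst w)) (snd w)) \<and>
      (\<forall>j\<ge>m1. s' j = s j) \<and> t \<le> (size (encode_pair (encode_pair E e) f w) + 2) ^ k1"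
    using step by (rule ptimeE) blast
  \<comment> \<open>\<open>M\<close>, \<open>M + 1\<close> and \<open>M + 2\<close> hold the
    environment, the rest of the list and the accumulator, out of reach of
    \<open>c1\<close>.\<close>
  define M where "M = Suc (max m0 m1)"
  have M: "M > 0" "m0 \<le> M" "m1 \<le> M" by (auto simp: M_def)
  define body where "body = Seq (Assign 0 (NodeE (NodeE (Var M) (LeftE (Var (M + 1)))) (Var (M + 2))))
    (Seq c1 (Seq (Assign (M + 2) (Var 0)) (Assign (M + 1) (RightE (Var (M + 1))))))"
  define loop where "loop = While (Var (M + 1)) body"
  define c where "c = Seq c0 (Seq (Assign M (LeftE (Var 0))) (Seq (Assign (M + 1) (LeftE (RightE (Var 0))))
    (Seq (Assign (M + 2) (RightE (RightE (Var 0)))) (Seq loop (Assign 0 (Var (M + 2)))))))"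
  \<comment> \<open>With fixed bounds \<open>l\<close> on the elements and \<open>B\<close> on the
    accumulators, all rounds share one time bound; the 20 covers the constant cost of a
    round.\<close>
  have loop: "\<exists>t s'. exec loop s t s' \<and> s' (M + 2) = f (fold (step a) ys y) \<and>
      (\<forall>j\<ge>M + 3. s' j = s j) \<and>
      t \<le> 2 + length ys * (20 + (size (E a) + l + B + 4) ^ k1)"
    if "s M = E a" "s (M + 1) = encode_list e ys" "s (M + 2) = f y"
      "\<And>x. x \<in> set ys \<Longrightarrow> size (e x) \<le> l"
      "\<And>us vs. ys = us @ vs \<Longrightarrow> size (f (fold (step a) us y)) \<le> B" for s a ys y l B
    using that
  proof (induction ys arbitrary: s y)
    case Nil
    then have "exec loop s 2 s"
      unfolding loop_def using exec.WhileFalse[of "Var (M + 1)" s body] by (simp add: numeral_2_eq_2)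
    then show ?case using Nil by fastforce
  next
    case (Cons x ys)
    let ?w = "((a, x), y)"
    define s1 where "s1 = s(0 := encode_pair (encode_pair E e) f ?w)"
    have "s1 0 = encode_pair (encode_pair E e) f ?w" by (simp add: s1_def)
    then obtain t1 s2 where 1: "exec c1 s1 t1 s2" "s2 0 = f (step a x y)" "\<forall>j\<ge>m1. s2 j = s1 j"
      "t1 \<le> (size (encode_pair (encode_pair E e) f ?w) + 2) ^ k1" using c1 by fastforce
    define s3 where "s3 = s2(M + 2 := f (step a x y))"
    define s4 where "s4 = s3(M + 1 := encode_list e ys)"
    have body: "exec body s (7 + (t1 + (2 + 3))) s4"
      unfolding body_def
    proof (intro exec.Seq)
      show "exec (Assign 0 (NodeE (NodeE (Var M) (LeftE (Var (M + 1)))) (Var (M + 2)))) s 7 s1"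
        by (rule exec_Assign) (auto simp: s1_def encode_pair_def Cons.prems(1) Cons.prems(2)[simplified] Cons.prems(3)[simplified])
      show "exec c1 s1 t1 s2" by fact
      show "exec (Assign (M + 2) (Var 0)) s2 2 s3" by (rule exec_Assign) (auto simp: s3_def 1)
      show "exec (Assign (M + 1) (RightE (Var (M + 1)))) s3 3 s4"
        using 1(3) M Cons.prems(2) by (intro exec_Assign) (auto simp: s4_def s3_def s1_def)
    qed
    have "size (encode_pair (encode_pair E e) f ?w) + 2 \<le> size (E a) + l + B + 4"
      using Cons.prems(4)[of x] Cons.prems(5)[of "[]"] by (auto simp: encode_pair_def)
    then have t1: "t1 \<le> (size (E a) + l + B + 4) ^ k1"
      using 1(4) le_trans power_mono by blast
    have "\<exists>t s'. exec loop s4 t s' \<and> s' (M + 2) = f (fold (step a) ys (step a x y)) \<and>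
      (\<forall>j\<ge>M + 3. s' j = s4 j) \<and>
      t \<le> 2 + length ys * (20 + (size (E a) + l + B + 4) ^ k1)"
    proof (rule Cons.IH)
      show "s4 M = E a" using 1(3) M Cons.prems(1) by (auto simp: s4_def s3_def s1_def)
      show "s4 (M + 1) = encode_list e ys" by (simp add: s4_def)
      show "s4 (M + 2) = f (step a x y)" by (simp add: s4_def s3_def)
      show "size (e z) \<le> l" if "z \<in> set ys" for z using Cons.prems(4) that by simp
      show "size (f (fold (step a) us (step a x y))) \<le> B" if "ys = us @ vs" for us vs
        using Cons.prems(5)[of "x # us" vs] that by simp
    qed
    then obtain t2 s5 where 2: "exec loop s4 t2 s5"
      "s5 (M + 2) = f (fold (step a) ys (step a x y))" "\<forall>j\<ge>M + 3. s5 j = s4 j"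
      "t2 \<le> 2 + length ys * (20 + (size (E a) + l + B + 4) ^ k1)" by blast
    have "exec loop s (cost (Var (M + 1)) + 1 + (7 + (t1 + (2 + 3))) + t2) s5"
      using Cons.prems(2) body 2(1) unfolding loop_def by (intro exec.WhileTrue) auto
    moreover have "\<forall>j\<ge>M + 3. s5 j = s j"
      using 1(3) 2(3) M by (auto simp: s4_def s3_def s1_def)
    ultimately show ?case using 2(2,4) t1
      by (intro exI conjI) auto
  qed
  show ?thesis
  proof (rule ptimeI)
    fix a and s :: state assume "s 0 = E a"
    then obtain t0 s0 where 0: "exec c0 s t0 s0"
      "s0 0 = Node (E a) (Node (encode_list e (xs a)) (f (init a)))" "\<forall>j\<ge>m0. s0 j = s j"
      "t0 \<le> (size (E a) + 2) ^ k0" using c0 by blast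
    define s1 where "s1 = s0(M := E a)"
    define s2 where "s2 = s1(M + 1 := encode_list e (xs a))"
    define s3 where "s3 = s2(M + 2 := f (init a))"
    let ?n = "size (E a)" let ?l = "(?n + 2) ^ k0"
    have l: "size (encode_list e (xs a)) \<le> ?l" using k0[of a] by simp
    have "\<exists>t s'. exec loop s3 t s' \<and> s' (M + 2) = f (fold (step a) (xs a) (init a)) \<and>
      (\<forall>j\<ge>M + 3. s' j = s3 j) \<and>
      t \<le> 2 + length (xs a) * (20 + (?n + ?l + b ?n + 4) ^ k1)"
    proof (rule loop)
      show "size (e x) \<le> ?l" if "x \<in> set (xs a)" for x
        using size_encode_list_elem[OF that, of e] l by simp
    qed (auto simp: s3_def s2_def s1_def bound)
    then obtain t1 s4 where 1: "exec loop s3 t1 s4"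
      "s4 (M + 2) = f (fold (step a) (xs a) (init a))" "\<forall>j\<ge>M + 3. s4 j = s3 j"
      "t1 \<le> 2 + length (xs a) * (20 + (?n + ?l + b ?n + 4) ^ k1)" by blast
    have "length (xs a) \<le> ?l" using l length_le_size_encode_list[of "xs a" e] by simp
    then have "length (xs a) * (20 + (?n + ?l + b ?n + 4) ^ k1) \<le>
      ?l * (20 + (?n + ?l + b ?n + 4) ^ k1)" by simp
    then have t1: "t1 \<le> 2 + ?l * (20 + (?n + ?l + b ?n + 4) ^ k1)" using 1(4) by linarith
    define s5 where "s5 = s4(0 := f (fold (step a) (xs a) (init a)))"
    have "exec c s (t0 + (3 + (4 + (4 + (t1 + 2))))) s5"
      unfolding c_def
    proof (intro exec.Seq)
      show "exec c0 s t0 s0" by fact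
      show "exec (Assign M (LeftE (Var 0))) s0 3 s1" by (rule exec_Assign) (auto simp: s1_def 0)
      show "exec (Assign (M + 1) (LeftE (RightE (Var 0)))) s1 4 s2"
        using M by (intro exec_Assign) (auto simp: s2_def s1_def 0)
      show "exec (Assign (M + 2) (RightE (RightE (Var 0)))) s2 4 s3"
        using M by (intro exec_Assign) (auto simp: s3_def s2_def s1_def 0)
      show "exec loop s3 t1 s4" by fact
      show "exec (Assign 0 (Var (M + 2))) s4 2 s5"
        using 1(2) by (intro exec_Assign) (auto simp: s5_def)
    qed
    moreover have "\<forall>j\<ge>M + 3. s5 j = s j"
      using 0(3) 1(3) M by (auto simp: s5_def s3_def s2_def s1_def)
    moreover have "s5 0 = f (fold (step a) (xs a) (init a))" by (simp add: s5_def)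
    ultimately show "\<exists>t s'. exec c s t s' \<and> s' 0 = f (fold (step a) (xs a) (init a)) \<and>
        (\<forall>j\<ge>M + 3. s' j = s j) \<and>
        t \<le> (\<lambda>n. (n + 2) ^ k0 + 15 + (n + 2) ^ k0 * (20 + (n + (n + 2) ^ k0 + b n + 4) ^ k1)) ?n \<and>
        size (f (fold (step a) (xs a) (init a))) \<le> b ?n"
      using 0(4) t1 bound[of a "xs a" "[]"] by (intro exI conjI) auto
  qed (intro poly_bounded_intros b)+
qed

section \<open>Booleans and lists\<close>

lemma ptime_if:
  assumes "ptime E (\<lambda>a. encode_bool (B a))" "ptime E (\<lambda>a. e (F a))" "ptime E (\<lambda>a. e (G a))"
  shows "ptime E (\<lambda>a. e (if B a then F a else G a))"
proof -
  have "(\<lambda>a. e (if B a then F a else G a)) =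
      (\<lambda>a. if encode_bool (B a) = Leaf then e (G a) else e (F a))"
    by (auto simp: encode_bool_def)
  then show ?thesis using ptime_if_Leaf[OF assms] by simp
qed

lemma ptime_is_Leaf:
  assumes "ptime E F"
  shows "ptime E (\<lambda>a. encode_bool (F a = Leaf))"
proof -
  have "(\<lambda>a. encode_bool (F a = Leaf)) = (\<lambda>a. if F a = Leaf then Node Leaf Leaf else Leaf)"
    by (auto simp: encode_bool_def)
  then show ?thesis
    using ptime_if_Leaf[OF assms ptime_Leaf ptime_Node[OF ptime_Leaf ptime_Leaf]] by simp
qed

lemma ptime_not:
  assumes "ptime E (\<lambda>a. encode_bool (A a))"
  shows "ptime E (\<lambda>a. encode_bool (\<not> A a))"
proof -
  have "(\<lambda>a. encode_bool (\<not> A a)) = (\<lambda>a. encode_bool (encode_bool (A a) = Leaf))"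
    by (auto simp: encode_bool_def)
  then show ?thesis using ptime_is_Leaf[OF assms] by simp
qed

lemma ptime_False: "ptime E (\<lambda>a. encode_bool False)"
  using ptime_Leaf[of E] by (simp add: encode_bool_def)

lemma ptime_conj:
  assumes "ptime E (\<lambda>a. encode_bool (A a))" "ptime E (\<lambda>a. encode_bool (B a))"
  shows "ptime E (\<lambda>a. encode_bool (A a \<and> B a))"
proof -
  have "(\<lambda>a. encode_bool (A a \<and> B a)) = (\<lambda>a. encode_bool (if A a then B a else False))" by auto
  then show ?thesis using ptime_if[where e = encode_bool, OF assms ptime_False] by simp
qed

lemma ptime_disj:
  assumes "ptime E (\<lambda>a. encode_bool (A a))" "ptime E (\<lambda>a. encode_bool (B a))"
  shows "ptime E (\<lambda>a. encode_bool (A a \<or> B a))"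
  using ptime_not[OF ptime_conj[OF ptime_not[OF assms(1)] ptime_not[OF assms(2)]]] by simp

lemma ptime_Nil: "ptime E (\<lambda>a. encode_list e [])"
  using ptime_Leaf[of E] by simp

lemma ptime_Cons:
  assumes "ptime E (\<lambda>a. e (F a))" "ptime E (\<lambda>a. encode_list e (G a))"
  shows "ptime E (\<lambda>a. encode_list e (F a # G a))"
  using ptime_Node[OF assms] by simp

lemma ptime_rev:
  assumes "ptime E (\<lambda>a. encode_list e (xs a))"
  shows "ptime E (\<lambda>a. encode_list e (rev (xs a)))"
proof -
  obtain k where k: "\<And>a. size (encode_list e (xs a)) \<le> (size (E a) + 2) ^ k"
    using ptime_size[OF assms] by blast
  have "ptime E (\<lambda>a. encode_list e (fold (#) (xs a) []))"
  proof (rule ptime_fold[where b = "\<lambda>n. (n + 2) ^ k"])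
    fix a ys zs assume "xs a = ys @ zs"
    then show "size (encode_list e (fold (#) ys [])) \<le> (size (E a) + 2) ^ k"
      using k[of a] by (simp add: size_encode_list fold_Cons_rev rev_map[symmetric])
  qed (rule assms ptime_Nil poly_bounded_power
      ptime_Cons[where e = e, OF ptime_weaken[OF ptime_var] ptime_var])+
  then show ?thesis by (simp add: fold_Cons_rev)
qed

lemma ptime_append:
  assumes xs: "ptime E (\<lambda>a. encode_list e (xs a))" and ys: "ptime E (\<lambda>a. encode_list e (ys a))"
  shows "ptime E (\<lambda>a. encode_list e (xs a @ ys a))"
proof -
  obtain k where k: "\<And>a. size (encode_list e (rev (xs a))) \<le> (size (E a) + 2) ^ k"
    using ptime_size[OF ptime_rev[OF xs]] by blast
  obtain l where l: "\<And>a. size (encode_list e (ys a)) \<le> (size (E a) + 2) ^ l"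
    using ptime_size[OF ys] by blast
  have "ptime E (\<lambda>a. encode_list e (fold (#) (rev (xs a)) (ys a)))"
  proof (rule ptime_fold[where b = "\<lambda>n. (n + 2) ^ k + (n + 2) ^ l"])
    fix a us vs assume "rev (xs a) = us @ vs"
    then show "size (encode_list e (fold (#) us (ys a))) \<le> (size (E a) + 2) ^ k + (size (E a) + 2) ^ l"
      using k[of a] l[of a] by (simp add: size_encode_list fold_Cons_rev rev_map[symmetric])
  qed (rule ptime_rev[OF xs] ys poly_bounded_add poly_bounded_power
      ptime_Cons[where e = e, OF ptime_weaken[OF ptime_var] ptime_var])+
  then show ?thesis by (simp add: fold_Cons_rev)
qed

text \<open>Map, filter and unary sums are instances. Folding over the reversed list makes
  prepending yield the right order; the size bound is the number of blocks times the largest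
  block.\<close>

lemma ptime_concat_map:
  assumes xs: "ptime E (\<lambda>a. encode_list e (xs a))"
    and g: "ptime (encode_pair E e) (\<lambda>w. encode_list f (g (fst w) (snd w)))"
  shows "ptime E (\<lambda>a. encode_list f (concat (map (g a) (xs a))))"
proof -
  obtain k where k: "\<And>a. size (encode_list e (rev (xs a))) \<le> (size (E a) + 2) ^ k"
    using ptime_size[OF ptime_rev[OF xs]] by blast
  obtain l where l: "\<And>w. size (encode_list f (g (fst w) (snd w))) \<le> (size (encode_pair E e w) + 2) ^ l"
    using ptime_size[OF g] by blast
  have fold: "fold (\<lambda>x acc. g a x @ acc) us [] = concat (map (g a) (rev us))" for a us
  proof -
    have "fold (\<lambda>x acc. g a x @ acc) us acc = concat (map (g a) (rev us)) @ acc" for acc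
      by (induction us arbitrary: acc) auto
    then show ?thesis by simp
  qed
  define B where "B n = (n + (n + 2) ^ k + 3) ^ l" for n :: nat
  have size_concat: "size (encode_list f (concat yss)) \<le> length yss * b"
    if "\<And>ys. ys \<in> set yss \<Longrightarrow> size (encode_list f ys) \<le> b" for yss b
    using that by (induction yss) (fastforce simp: size_encode_list)+
  have "ptime E (\<lambda>a. encode_list f (fold (\<lambda>x acc. g a x @ acc) (rev (xs a)) []))"
  proof (rule ptime_fold[where b = "\<lambda>n. (n + 2) ^ k * B n" and step = "\<lambda>a x acc. g a x @ acc"])
    fix a us vs assume us: "rev (xs a) = us @ vs"
    have x: "size (encode_list f (g a x)) \<le> B (size (E a))" if "x \<in> set us" for x
    proof -
      have "size (e x) < size (encode_list e (rev (xs a)))"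
        using that us by (intro size_encode_list_elem) auto
      then have "size (encode_pair E e (a, x)) + 2 \<le> size (E a) + (size (E a) + 2) ^ k + 3"
        using k[of a] by (simp add: encode_pair_def)
      then have "(size (encode_pair E e (a, x)) + 2) ^ l \<le> B (size (E a))"
        unfolding B_def by (intro power_mono) auto
      then show ?thesis using l[of "(a, x)"] by simp
    qed
    have "length us \<le> (size (E a) + 2) ^ k"
      using k[of a] length_le_size_encode_list[of "rev (xs a)" e] us by simp
    moreover have "size (encode_list f (concat (map (g a) (rev us)))) \<le> length us * B (size (E a))"
      using size_concat[of "map (g a) (rev us)" "B (size (E a))"] x by auto
    ultimately show "size (encode_list f (fold (\<lambda>x acc. g a x @ acc) us [])) \<le>
        (size (E a) + 2) ^ k * B (size (E a))"
      unfolding fold using le_trans mult_le_mono1 by blast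
  next
    show "poly_bounded (\<lambda>n. (n + 2) ^ k * B n)" unfolding B_def by (intro poly_bounded_intros)
  qed (rule ptime_rev[OF xs] ptime_Nil ptime_append[OF ptime_weaken[OF g] ptime_var])+
  then show ?thesis by (simp add: fold)
qed

lemma ptime_map:
  assumes "ptime E (\<lambda>a. encode_list e (xs a))"
    and "ptime (encode_pair E e) (\<lambda>w. f (g (fst w) (snd w)))"
  shows "ptime E (\<lambda>a. encode_list f (map (g a) (xs a)))"
proof -
  have "concat (map (\<lambda>x. [h x]) ys) = map h ys" for h :: "'b \<Rightarrow> 'c" and ys by (induction ys) auto
  then show ?thesis
    using ptime_concat_map[OF assms(1), of f "\<lambda>a x. [g a x]"] ptime_Cons[where e = f, OF assms(2) ptime_Nil]
    by simp
qed

lemma ptime_filter: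
  assumes "ptime E (\<lambda>a. encode_list e (xs a))"
    and "ptime (encode_pair E e) (\<lambda>w. encode_bool (P (fst w) (snd w)))"
  shows "ptime E (\<lambda>a. encode_list e (filter (P a) (xs a)))"
proof -
  have "concat (map (\<lambda>x. if Q x then [x] else []) ys) = filter Q ys" for Q :: "'b \<Rightarrow> bool" and ys
    by (induction ys) auto
  then show ?thesis
    using ptime_concat_map[OF assms(1), of e "\<lambda>a x. if P a x then [x] else []"]
      ptime_if[where e = "encode_list e", OF assms(2)
        ptime_Cons[where e = e, OF ptime_var ptime_Nil] ptime_Nil]
    by simp
qed

section \<open>Unary arithmetic\<close>

lemma encode_list_Leaf: "encode_list (\<lambda>_. Leaf) xs = encode_nat (length xs)"
  by (induction xs) auto

text \<open>A unary number is a list of leaves, so encoding every element by a leaf turns the list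
  into its length. Read backwards, this lets list operations serve as arithmetic.\<close>

lemma ptime_length:
  assumes "ptime E (\<lambda>a. encode_list e (xs a))"
  shows "ptime E (\<lambda>a. encode_nat (length (xs a)))"
  using ptime_map[where f = "\<lambda>_. Leaf" and g = "\<lambda>_ _. ()", OF assms ptime_Leaf] by (simp add: encode_list_Leaf)

lemma ptime_units:
  "ptime E (\<lambda>a. encode_nat (F a)) = ptime E (\<lambda>a. encode_list (\<lambda>_. Leaf) (replicate (F a) ()))"
  by (simp add: encode_list_Leaf)

lemma ptime_sum_list:
  assumes "ptime E (\<lambda>a. encode_list e (xs a))"
    and "ptime (encode_pair E e) (\<lambda>w. encode_nat (f (fst w) (snd w)))"
  shows "ptime E (\<lambda>a. encode_nat (\<Sum>x\<leftarrow>xs a. f a x))"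
proof -
  have "length (concat (map (\<lambda>x. replicate (h x) ()) ys)) = (\<Sum>x\<leftarrow>ys. h x)" for h :: "'b \<Rightarrow> nat" and ys
    by (induction ys) auto
  then show ?thesis
    using ptime_concat_map[OF assms(1) assms(2)[unfolded ptime_units]]
    by (simp add: encode_list_Leaf)
qed

lemma ptime_0: "ptime E (\<lambda>_. encode_nat 0)"
  using ptime_Leaf[of E] by simp

lemma ptime_Suc:
  assumes "ptime E (\<lambda>a. encode_nat (F a))"
  shows "ptime E (\<lambda>a. encode_nat (Suc (F a)))"
  using ptime_Node[OF ptime_Leaf assms] by simp

lemma ptime_mult:
  assumes "ptime E (\<lambda>a. encode_nat (F a))" "ptime E (\<lambda>a. encode_nat (G a))"
  shows "ptime E (\<lambda>a. encode_nat (F a * G a))"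
  using ptime_sum_list[where f = "\<lambda>a _. G a", OF assms(1)[unfolded ptime_units] ptime_weaken[OF assms(2)]]
  by (simp add: sum_list_replicate)

lemma ptime_funpow_right:
  assumes "ptime E (\<lambda>a. encode_nat (K a))" "ptime E F"
  shows "ptime E (\<lambda>a. (right ^^ K a) (F a))"
proof -
  obtain k where k: "\<And>a. size (F a) \<le> (size (E a) + 2) ^ k" using ptime_size[OF assms(2)] by blast
  have fold: "fold (\<lambda>_. right) ys t = (right ^^ length ys) t" for ys :: "unit list" and t
    by (induction ys arbitrary: t) (auto simp: funpow_swap1)
  have "size (right t) \<le> size t" for t by (cases t) auto
  then have size: "size ((right ^^ j) t) \<le> size t" for j t
    by (induction j) (auto intro: le_trans)
  have "ptime E (\<lambda>a. fold (\<lambda>_. right) (replicate (K a) ()) (F a))"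
    by (rule ptime_fold[where f = "\<lambda>t. t" and b = "\<lambda>n. (n + 2) ^ k", OF assms(1)[unfolded ptime_units]])
      (simp_all only: fold le_trans[OF size k] assms(2) ptime_right[OF ptime_var[where e = "\<lambda>t. t"]] poly_bounded_power)
  then show ?thesis by (simp add: fold)
qed

lemma ptime_diff:
  assumes "ptime E (\<lambda>a. encode_nat (F a))" "ptime E (\<lambda>a. encode_nat (G a))"
  shows "ptime E (\<lambda>a. encode_nat (F a - G a))"
proof -
  have "right (encode_nat n) = encode_nat (n - 1)" for n by (cases n) auto
  then have "(right ^^ j) (encode_nat n) = encode_nat (n - j)" for j n by (induction j) auto
  then show ?thesis using ptime_funpow_right[OF assms(2,1)] by simp
qed

lemma ptime_le:
  assumes "ptime E (\<lambda>a. encode_nat (F a))" "ptime E (\<lambda>a. encode_nat (G a))"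
  shows "ptime E (\<lambda>a. encode_bool (F a \<le> G a))"
proof -
  have "(encode_nat n = Leaf) = (n = 0)" for n by (cases n) auto
  then show ?thesis using ptime_is_Leaf[OF ptime_diff[OF assms]] by simp
qed

lemma ptime_less:
  assumes "ptime E (\<lambda>a. encode_nat (F a))" "ptime E (\<lambda>a. encode_nat (G a))"
  shows "ptime E (\<lambda>a. encode_bool (F a < G a))"
  using ptime_not[OF ptime_le[OF assms(2,1)]] by (simp add: not_le)

lemma ptime_eq:
  assumes "ptime E (\<lambda>a. encode_nat (F a))" "ptime E (\<lambda>a. encode_nat (G a))"
  shows "ptime E (\<lambda>a. encode_bool (F a = G a))"
  using ptime_conj[OF ptime_le[OF assms] ptime_le[OF assms(2,1)]] by (simp add: eq_iff)

lemma ptime_upt: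
  assumes "ptime E (\<lambda>a. encode_nat (F a))"
  shows "ptime E (\<lambda>a. encode_list encode_nat [0..<F a])"
proof -
  obtain k where k: "\<And>a. F a \<le> (size (E a) + 2) ^ k" using ptime_size[OF assms] by auto
  \<comment> \<open>The length of the accumulator is itself the next number to prepend, which saves
    a counter.\<close>
  have fold: "fold (\<lambda>_ l. length l # l) ys [] = rev [0..<length ys]" for ys :: "unit list"
    by (induction ys rule: rev_induct) auto
  have "ptime E (\<lambda>a. encode_list encode_nat (fold (\<lambda>_ l. length l # l) (replicate (F a) ()) []))"
  proof (rule ptime_fold[where b = "\<lambda>n. (n + 2) ^ k * Suc ((n + 2) ^ k)"
        and step = "\<lambda>_ _ l. length l # l", OF assms[unfolded ptime_units]])
    fix a and ys zs :: "unit list" assume "replicate (F a) () = ys @ zs"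
    then have "length (replicate (F a) ()) = length (ys @ zs)" by (rule arg_cong)
    then have len: "length ys \<le> (size (E a) + 2) ^ k" using k[of a] by simp
    have "size (encode_list encode_nat (rev [0..<length ys])) \<le> length ys * Suc (length ys)"
      using size_encode_list_le[of "rev [0..<length ys]" encode_nat "length ys"] by auto
    also have "\<dots> \<le> (size (E a) + 2) ^ k * Suc ((size (E a) + 2) ^ k)"
      using len by (intro mult_mono) auto
    finally show "size (encode_list encode_nat (fold (\<lambda>_ l. length l # l) ys [])) \<le>
        (size (E a) + 2) ^ k * Suc ((size (E a) + 2) ^ k)" unfolding fold .
  next
    show "poly_bounded (\<lambda>n. (n + 2) ^ k * Suc ((n + 2) ^ k))"
      unfolding Suc_eq_plus1 by (intro poly_bounded_intros)
  qed (rule ptime_Nil ptime_Cons ptime_length[where e = encode_nat] ptime_var)+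
  from ptime_rev[OF this] show ?thesis by (simp only: fold length_replicate rev_rev_ident)
qed

section \<open>Maximization over a list\<close>

definition best :: "('a \<Rightarrow> nat) \<Rightarrow> 'a list \<Rightarrow> 'a \<Rightarrow> 'a" where
  "best f xs d = fold (\<lambda>x y. if f y < f x then x else y) xs d"

lemma best_in: "best f xs d \<in> insert d (set xs)"
  unfolding best_def by (induction xs arbitrary: d) fastforce+

lemma best_ge: "x \<in> insert d (set xs) \<Longrightarrow> f x \<le> f (best f xs d)"
proof (induction xs arbitrary: d x)
  case (Cons y ys)
  have "f d \<le> f (best f (y # ys) d)" "f y \<le> f (best f (y # ys) d)"
    using Cons.IH[where x = "if f d < f y then y else d" and d = "if f d < f y then y else d"]
    by (auto simp: best_def split: if_splits)
  moreover have "f x \<le> f (best f (y # ys) d)" if "x \<in> set ys"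
    using Cons.IH[where x = x and d = "if f d < f y then y else d"] that by (simp add: best_def)
  ultimately show ?case using Cons.prems by auto
qed (simp add: best_def)

lemma ptime_best:
  assumes xs: "ptime E (\<lambda>a. encode_list e (xs a))" and d: "ptime E (\<lambda>a. e (d a))"
    and f: "ptime (encode_pair E e) (\<lambda>w. encode_nat (f (fst w) (snd w)))"
  shows "ptime E (\<lambda>a. e (best (f a) (xs a) (d a)))"
proof -
  obtain k where k: "\<And>a. size (encode_list e (xs a)) \<le> (size (E a) + 2) ^ k"
    using ptime_size[OF xs] by blast
  obtain l where l: "\<And>a. size (e (d a)) \<le> (size (E a) + 2) ^ l" using ptime_size[OF d] by blast
  show ?thesis unfolding best_def
  proof (rule ptime_fold[where b = "\<lambda>n. (n + 2) ^ k + (n + 2) ^ l"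
        and step = "\<lambda>a x y. if f a y < f a x then x else y", OF xs d])
    fix a ys zs assume "xs a = ys @ zs"
    then have "best (f a) ys (d a) = d a \<or> best (f a) ys (d a) \<in> set (xs a)"
      using best_in[of "f a" ys "d a"] by auto
    then have "size (e (best (f a) ys (d a))) \<le> (size (E a) + 2) ^ k + (size (E a) + 2) ^ l"
      using k[of a] l[of a] size_encode_list_elem[of _ "xs a" e] by fastforce
    then show "size (e (fold (\<lambda>x y. if f a y < f a x then x else y) ys (d a))) \<le>
      (size (E a) + 2) ^ k + (size (E a) + 2) ^ l" by (simp add: best_def)
  next
    \<comment> \<open>The step evaluates \<open>f\<close> also at the accumulator, which is bound
      inside the list element; the environment is rearranged so that the accumulator takes the place
      of the element.\<close>
    have "ptime (encode_pair (encode_pair E e) e) (\<lambda>w. encode_pair E e (fst (fst w), snd w))"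
      by (intro ptime_Pair ptime_weaken[OF ptime_env] ptime_var)
    from ptime_comp[OF this f]
    show "ptime (encode_pair (encode_pair E e) e) (\<lambda>w. e (if f (fst (fst w)) (snd w)
        < f (fst (fst w)) (snd (fst w)) then snd (fst w) else snd w))"
      by (intro ptime_if ptime_less ptime_var ptime_weaken[OF ptime_var] ptime_weaken[OF f]) simp
  qed (intro poly_bounded_add poly_bounded_power)
qed

section \<open>The algorithm\<close>

text \<open>The range conditions make this agree with the encoded matrix at all arguments, since
  reading outside a list or at a non-edge gives a leaf, that is, false. Hence
  \<open>ptime_holds\<close> has no side conditions.\<close>

definition holds :: "csp \<Rightarrow> nat \<Rightarrow> nat \<Rightarrow> nat \<Rightarrow> nat \<Rightarrow> bool" where
  "holds I u v a b \<longleftrightarrow> u < num_vertices I \<and> v < num_vertices I \<and> (u, v) \<in> edges I \<and>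
    a < alphabet I \<and> b < alphabet I \<and> constraint I (u, v) a b"

text \<open>Adjacency of \<open>(u, a)\<close> and \<open>(v, b)\<close> in the label-extended graph.\<close>

definition adj :: "csp \<Rightarrow> nat \<Rightarrow> nat \<Rightarrow> nat \<Rightarrow> nat \<Rightarrow> bool" where
  "adj I u a v b \<longleftrightarrow> holds I u v a b \<or> holds I v u b a"

lemma ptime_alphabet:
  assumes "ptime E (\<lambda>z. encode_csp (I z))"
  shows "ptime E (\<lambda>z. encode_nat (alphabet (I z)))"
  using ptime_left[OF assms] by (simp add: encode_csp_def)

lemma ptime_num_vertices:
  assumes "ptime E (\<lambda>z. encode_csp (I z))"
  shows "ptime E (\<lambda>z. encode_nat (num_vertices (I z)))"
  using ptime_left[OF ptime_right[OF assms]] by (simp add: encode_csp_def)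

definition nth_tree :: "tree \<Rightarrow> nat \<Rightarrow> tree" where
  "nth_tree t k = left ((right ^^ k) t)"

lemma nth_tree_Leaf: "nth_tree Leaf k = Leaf"
proof -
  have "(right ^^ k) Leaf = Leaf" by (induction k) auto
  then show ?thesis by (simp add: nth_tree_def)
qed

lemma nth_tree_encode_list:
  "nth_tree (encode_list e xs) k = (if k < length xs then e (xs ! k) else Leaf)"
proof (induction k arbitrary: xs)
  case 0
  show ?case by (cases xs) (auto simp: nth_tree_def)
next
  case (Suc k)
  show ?case
  proof (cases xs)
    case Nil
    then show ?thesis using nth_tree_Leaf by simp
  next
    case (Cons x xs')
    then show ?thesis using Suc[of xs'] by (simp add: nth_tree_def funpow_Suc_right del: funpow.simps)
  qed
qed

lemma ptime_nth_tree:
  "ptime E F \<Longrightarrow> ptime E (\<lambda>z. encode_nat (k z)) \<Longrightarrow> ptime E (\<lambda>z. nth_tree (F z) (k z))"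
  unfolding nth_tree_def by (intro ptime_left ptime_funpow_right)

lemma ptime_holds:
  assumes "ptime E (\<lambda>z. encode_csp (I z))" "ptime E (\<lambda>z. encode_nat (u z))"
    "ptime E (\<lambda>z. encode_nat (v z))" "ptime E (\<lambda>z. encode_nat (a z))"
    "ptime E (\<lambda>z. encode_nat (b z))"
  shows "ptime E (\<lambda>z. encode_bool (holds (I z) (u z) (v z) (a z) (b z)))"
proof -
  have "nth_tree (nth_tree (nth_tree (nth_tree (right (right (encode_csp J))) u) v) a) b =
      encode_bool (holds J u v a b)" for J u v a b
    by (simp add: encode_csp_def encode_table_def nth_tree_encode_list nth_tree_Leaf holds_def
        encode_bool_def)
  moreover have "ptime E (\<lambda>z. nth_tree (nth_tree (nth_tree (nth_tree
      (right (right (encode_csp (I z)))) (u z)) (v z)) (a z)) (b z))"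
    by (intro ptime_nth_tree ptime_right assms)
  ultimately show ?thesis by simp
qed

lemma ptime_adj:
  assumes "ptime E (\<lambda>z. encode_csp (I z))" "ptime E (\<lambda>z. encode_nat (u z))"
    "ptime E (\<lambda>z. encode_nat (a z))" "ptime E (\<lambda>z. encode_nat (v z))"
    "ptime E (\<lambda>z. encode_nat (b z))"
  shows "ptime E (\<lambda>z. encode_bool (adj (I z) (u z) (a z) (v z) (b z)))"
  unfolding adj_def by (intro ptime_disj ptime_holds assms)

text \<open>A family assigns to each vertex a list of candidate labels, repetitions acting as weights.\<close>

type_synonym family = "(nat \<times> nat list) list"

abbreviation encode_entry :: "nat \<times> nat list \<Rightarrow> tree" where
  "encode_entry \<equiv> encode_pair encode_nat (encode_list encode_nat)"

abbreviation encode_family :: "family \<Rightarrow> tree" where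
  "encode_family \<equiv> encode_list encode_entry"

definition score :: "csp \<Rightarrow> family \<Rightarrow> nat \<Rightarrow> nat \<Rightarrow> nat" where
  "score I M u a = (\<Sum>p\<leftarrow>M. length (filter (adj I u a (fst p)) (snd p)))"

definition response :: "csp \<Rightarrow> family \<Rightarrow> nat \<Rightarrow> nat" where
  "response I M u = best (score I M u) [0..<alphabet I] 0"

text \<open>On a valid instance whose lists all have length 2, this is four times the expected
  number of compatible ordered pairs when every vertex draws uniformly and independently from its
  list. It is the quantity tracked by the derandomization.\<close>

definition total_score :: "csp \<Rightarrow> family \<Rightarrow> nat" where
  "total_score I M = (\<Sum>p\<leftarrow>M. \<Sum>a\<leftarrow>snd p. score I M (fst p) a)"

definition refine :: "csp \<Rightarrow> family \<Rightarrow> nat \<Rightarrow> nat \<Rightarrow> family" where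
  "refine I M u a = map (\<lambda>p. (fst p, filter (adj I u a (fst p)) (snd p))) M"

text \<open>
  A list of length \<open>l\<close> is replaced by \<open>\<lfloor>q / l\<rfloor>\<close> copies of itself, so that up to a factor \<open>2\<close> all
  nonempty lists get length \<open>q\<close> and counting with multiplicity is averaging over each list.
\<close>

definition equalize :: "csp \<Rightarrow> family \<Rightarrow> family" where
  "equalize I M = map (\<lambda>p. (fst p, concat (map (\<lambda>i.
    if Suc i * length (snd p) \<le> alphabet I then snd p else []) [0..<alphabet I]))) M"

definition responses :: "csp \<Rightarrow> family \<Rightarrow> family" where
  "responses I M = map (\<lambda>u. (u, [response I M u])) [0..<num_vertices I]"

definition two_labels :: "csp \<Rightarrow> family \<Rightarrow> family" where
  "two_labels I M = map (\<lambda>u. (u, [response I M u, response I (responses I M) u])) [0..<num_vertices I]"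

text \<open>The chosen label is doubled so that settled and unsettled vertices carry equal weight in
  scores.\<close>

definition settle :: "csp \<Rightarrow> nat \<Rightarrow> family \<Rightarrow> family" where
  "settle I u M = map (\<lambda>p. (fst p, if fst p = u then [response I M u, response I M u] else snd p)) M"

definition round_family :: "csp \<Rightarrow> family \<Rightarrow> family" where
  "round_family I M = fold (settle I) [0..<num_vertices I] (two_labels I (equalize I M))"

text \<open>The depth depends on \<gamma> but not on the instance. The default
  \<open>round_family I M\<close> lets the search stop at any level, so tuples of every length up to
  the depth are tried.\<close>

primrec search :: "nat \<Rightarrow> csp \<Rightarrow> family \<Rightarrow> family" where
  "search 0 I M = round_family I M"
| "search (Suc d) I M = best (total_score I) (map (\<lambda>u. best (total_score I)
      (map (\<lambda>a. search d I (refine I M u a)) [0..<alphabet I]) (round_family I M))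
    [0..<num_vertices I]) (round_family I M)"

definition full_family :: "csp \<Rightarrow> family" where
  "full_family I = map (\<lambda>u. (u, [0..<alphabet I])) [0..<num_vertices I]"

text \<open>The default 0 is what \<open>left\<close> returns on the encoding of the empty
  list.\<close>

definition first_label :: "nat list \<Rightarrow> nat" where
  "first_label L = (if L = [] then 0 else hd L)"

definition solve :: "nat \<Rightarrow> csp \<Rightarrow> nat list" where
  "solve d I = map (\<lambda>p. first_label (snd p)) (search d I (full_family I))"

section \<open>Running time of the algorithm\<close>

lemma ptime_score:
  assumes "ptime E (\<lambda>z. encode_csp (I z))" "ptime E (\<lambda>z. encode_family (M z))"
    "ptime E (\<lambda>z. encode_nat (u z))" "ptime E (\<lambda>z. encode_nat (a z))"
  shows "ptime E (\<lambda>z. encode_nat (score (I z) (M z) (u z) (a z)))"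
  unfolding score_def
  by (rule assms ptime_sum_list[OF assms(2)] ptime_length[where e = encode_nat] ptime_filter
      ptime_adj ptime_fst[where f = "encode_list encode_nat"] ptime_snd[where e = encode_nat]
      ptime_var assms[THEN ptime_weaken] assms[THEN ptime_weaken, THEN ptime_weaken]
      ptime_weaken[OF ptime_var])+

lemma ptime_response:
  assumes "ptime E (\<lambda>z. encode_csp (I z))" "ptime E (\<lambda>z. encode_family (M z))"
    "ptime E (\<lambda>z. encode_nat (u z))"
  shows "ptime E (\<lambda>z. encode_nat (response (I z) (M z) (u z)))"
  unfolding response_def
  by (rule ptime_best[where e = encode_nat] ptime_upt ptime_alphabet assms ptime_0 ptime_score
      assms[THEN ptime_weaken] ptime_var)+

lemma ptime_total_score:
  assumes "ptime E (\<lambda>z. encode_csp (I z))" "ptime E (\<lambda>z. encode_family (M z))"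
  shows "ptime E (\<lambda>z. encode_nat (total_score (I z) (M z)))"
  unfolding total_score_def
  by (rule ptime_sum_list[OF assms(2)] ptime_sum_list[where e = encode_nat]
      ptime_score ptime_fst[where f = "encode_list encode_nat"] ptime_snd[where e = encode_nat]
      ptime_var assms[THEN ptime_weaken] assms[THEN ptime_weaken, THEN ptime_weaken]
      ptime_weaken[OF ptime_var])+

lemma ptime_refine:
  assumes "ptime E (\<lambda>z. encode_csp (I z))" "ptime E (\<lambda>z. encode_family (M z))"
    "ptime E (\<lambda>z. encode_nat (u z))" "ptime E (\<lambda>z. encode_nat (a z))"
  shows "ptime E (\<lambda>z. encode_family (refine (I z) (M z) (u z) (a z)))"
  unfolding refine_def
  by (rule ptime_map[OF assms(2)] ptime_Pair ptime_filter
      ptime_adj ptime_fst[where f = "encode_list encode_nat"] ptime_snd[where e = encode_nat]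
      ptime_var assms[THEN ptime_weaken] assms[THEN ptime_weaken, THEN ptime_weaken]
      ptime_weaken[OF ptime_var])+

lemma ptime_equalize:
  assumes "ptime E (\<lambda>z. encode_csp (I z))" "ptime E (\<lambda>z. encode_family (M z))"
  shows "ptime E (\<lambda>z. encode_family (equalize (I z) (M z)))"
  unfolding equalize_def
  by (rule ptime_map[OF assms(2)] ptime_Pair ptime_concat_map[where e = encode_nat] ptime_upt
      ptime_if[where e = "encode_list encode_nat"] ptime_le ptime_mult ptime_Suc ptime_Nil
      ptime_length[where e = encode_nat] ptime_alphabet
      ptime_fst[where f = "encode_list encode_nat"] ptime_snd[where e = encode_nat]
      ptime_var assms[THEN ptime_weaken] assms[THEN ptime_weaken, THEN ptime_weaken]
      ptime_weaken[OF ptime_var])+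

lemma ptime_responses:
  assumes "ptime E (\<lambda>z. encode_csp (I z))" "ptime E (\<lambda>z. encode_family (M z))"
  shows "ptime E (\<lambda>z. encode_family (responses (I z) (M z)))"
  unfolding responses_def
  by (rule ptime_map[where e = encode_nat] ptime_upt ptime_num_vertices assms ptime_Pair
      ptime_Cons ptime_Nil ptime_response ptime_var assms[THEN ptime_weaken])+

lemma ptime_two_labels:
  assumes "ptime E (\<lambda>z. encode_csp (I z))" "ptime E (\<lambda>z. encode_family (M z))"
  shows "ptime E (\<lambda>z. encode_family (two_labels (I z) (M z)))"
  unfolding two_labels_def
  by (rule ptime_map[where e = encode_nat] ptime_upt ptime_num_vertices assms ptime_Pair
      ptime_Cons ptime_Nil ptime_response ptime_responses ptime_var assms[THEN ptime_weaken])+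

lemma ptime_settle:
  assumes "ptime E (\<lambda>z. encode_csp (I z))" "ptime E (\<lambda>z. encode_family (M z))"
    "ptime E (\<lambda>z. encode_nat (u z))"
  shows "ptime E (\<lambda>z. encode_family (settle (I z) (u z) (M z)))"
  unfolding settle_def
  by (rule ptime_map[OF assms(2)] ptime_Pair ptime_if[where e = "encode_list encode_nat"] ptime_eq
      ptime_Cons ptime_Nil ptime_response ptime_var assms[THEN ptime_weaken]
      ptime_fst[where f = "encode_list encode_nat"] ptime_snd[where e = encode_nat])+

text \<open>The inequality is weak because running times are bounded on all records of type
  \<open>csp\<close>, including those with alphabet 0, where the default label 0 is
  returned.\<close>

lemma response_le: "response I M u \<le> alphabet I"
  using best_in[of "score I M u" "[0..<alphabet I]" 0] by (auto simp: response_def)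

lemma ptime_round_family:
  assumes "ptime E (\<lambda>z. encode_csp (I z))" "ptime E (\<lambda>z. encode_family (M z))"
  shows "ptime E (\<lambda>z. encode_family (round_family (I z) (M z)))"
proof -
  obtain k where "\<And>z. size (encode_csp (I z)) \<le> (size (E z) + 2) ^ k"
    using ptime_size[OF assms(1)] by blast
  moreover have "num_vertices J \<le> size (encode_csp J)" "alphabet J \<le> size (encode_csp J)" for J
    by (auto simp: encode_csp_def)
  ultimately have k: "num_vertices (I z) \<le> (size (E z) + 2) ^ k" "alphabet (I z) \<le> (size (E z) + 2) ^ k" for z
    by (meson le_trans)+
  \<comment> \<open>The fold needs a size bound that does not grow with the rounds: there are always
    n entries with two labels each, and all numbers are at most n or q.\<close>
  let ?inv = "\<lambda>J N. length N = num_vertices J \<and>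
    (\<forall>p\<in>set N. fst p \<le> num_vertices J \<and> length (snd p) = 2 \<and> (\<forall>a\<in>set (snd p). a \<le> alphabet J))"
  have inv: "?inv J (fold (settle J) us (two_labels J N))" for J us N
  proof (induction us rule: rev_induct)
    case Nil
    then show ?case by (auto simp: two_labels_def response_le)
  next
    case (snoc u us)
    then show ?case by (auto simp: settle_def response_le)
  qed
  have size: "size (encode_family (fold (settle J) us (two_labels J N))) \<le> B * Suc (B + 2 * Suc B + 1)"
    if B: "num_vertices J \<le> B" "alphabet J \<le> B" for J us N B
  proof -
    let ?N = "fold (settle J) us (two_labels J N)"
    have "size (encode_entry p) \<le> B + 2 * Suc B + 1" if p: "p \<in> set ?N" for p
    proof -
      have "size (encode_list encode_nat (snd p)) \<le> length (snd p) * Suc B"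
        using inv[of J us N] p B by (intro size_encode_list_le) fastforce
      moreover have "fst p \<le> B" "length (snd p) = 2" using inv[of J us N] p B by fastforce+
      ultimately show ?thesis by (simp add: encode_pair_def)
    qed
    then have "size (encode_family ?N) \<le> length ?N * Suc (B + 2 * Suc B + 1)"
      by (rule size_encode_list_le)
    also have "\<dots> \<le> B * Suc (B + 2 * Suc B + 1)" using inv[of J us N] B by (intro mult_mono) auto
    finally show ?thesis .
  qed
  show ?thesis unfolding round_family_def
  proof (rule ptime_fold[where e = encode_nat and step = "\<lambda>z. settle (I z)"
        and b = "\<lambda>n. (n + 2) ^ k * Suc ((n + 2) ^ k + 2 * Suc ((n + 2) ^ k) + 1)"])
    show "poly_bounded (\<lambda>n. (n + 2) ^ k * Suc ((n + 2) ^ k + 2 * Suc ((n + 2) ^ k) + 1))"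
      unfolding Suc_eq_plus1 by (intro poly_bounded_intros)
  qed (rule size k ptime_upt ptime_num_vertices ptime_two_labels ptime_equalize assms ptime_settle
      assms[THEN ptime_weaken, THEN ptime_weaken] ptime_var ptime_weaken[OF ptime_var])+
qed

text \<open>By induction on the depth: each level wraps two loops around the program for the level
  below, so the degree of the polynomial may depend on \<open>d\<close>.\<close>

lemma ptime_search:
  "ptime (encode_pair encode_csp encode_family) (\<lambda>z. encode_family (search d (fst z) (snd z)))"
proof (induction d)
  case 0
  show ?case using ptime_round_family[OF ptime_env ptime_var] by simp
next
  case (Suc d)
  let ?E = "encode_pair encode_csp encode_family"
  let ?E2 = "encode_pair (encode_pair ?E encode_nat) encode_nat"
  have "ptime ?E2 (\<lambda>w. ?E (fst (fst (fst w)), refine (fst (fst (fst w))) (snd (fst (fst w))) (snd (fst w)) (snd w)))"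
    by (rule ptime_Pair ptime_refine ptime_var ptime_weaken[OF ptime_var]
        ptime_weaken[OF ptime_weaken[OF ptime_var]] ptime_weaken[OF ptime_weaken[OF ptime_env]])+
  from ptime_comp[OF this Suc]
  have *: "ptime ?E2 (\<lambda>w. encode_family (search d (fst (fst (fst w)))
      (refine (fst (fst (fst w))) (snd (fst (fst w))) (snd (fst w)) (snd w))))" by simp
  show ?case unfolding search.simps
    by (rule * ptime_best[where e = encode_family] ptime_map[where e = encode_nat] ptime_upt
        ptime_alphabet ptime_num_vertices ptime_round_family ptime_total_score
        ptime_env ptime_var ptime_weaken[OF ptime_var] ptime_weaken[OF ptime_env]
        ptime_weaken[OF ptime_weaken[OF ptime_env]])+
qed

lemma ptime_full_family:
  assumes "ptime E (\<lambda>z. encode_csp (I z))"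
  shows "ptime E (\<lambda>z. encode_family (full_family (I z)))"
  unfolding full_family_def
  by (rule ptime_map[where e = encode_nat] ptime_upt ptime_num_vertices ptime_alphabet assms ptime_Pair
      ptime_var assms[THEN ptime_weaken])+

lemma ptime_first_label:
  assumes "ptime E (\<lambda>z. encode_list encode_nat (L z))"
  shows "ptime E (\<lambda>z. encode_nat (first_label (L z)))"
proof -
  have "left (encode_list encode_nat L) = encode_nat (first_label L)" for L
    by (cases L) (auto simp: first_label_def)
  then show ?thesis using ptime_left[OF assms] by simp
qed

lemma ptime_solve: "ptime encode_csp (\<lambda>I. encode_list encode_nat (solve d I))"
proof -
  have "ptime encode_csp (\<lambda>I. encode_pair encode_csp encode_family (I, full_family I))"
    by (rule ptime_Pair ptime_full_family ptime_refl)+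
  from ptime_comp[OF this ptime_search]
  have *: "ptime encode_csp (\<lambda>I. encode_family (search d I (full_family I)))" by simp
  show ?thesis unfolding solve_def
    by (rule ptime_map[OF *] ptime_first_label ptime_snd[where e = encode_nat] ptime_var)+
qed

section \<open>Rounding a family of candidate lists\<close>

text \<open>Every family built from \<open>full_family\<close> has this form, so the analysis can
  work with a function from vertices to lists.\<close>

definition fam :: "csp \<Rightarrow> (nat \<Rightarrow> nat list) \<Rightarrow> family" where
  "fam I L = map (\<lambda>v. (v, L v)) [0..<num_vertices I]"

lemma adj_sym: "adj I u a v b = adj I v b u a"
  by (auto simp: adj_def)

lemma adj_irrefl: "max_2csp I \<Longrightarrow> \<not> adj I u a u b"
  by (auto simp: adj_def holds_def max_2csp_def)

lemma fam_cong: "(\<And>v. v < num_vertices I \<Longrightarrow> L v = L' v) \<Longrightarrow> fam I L = fam I L'"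
  by (auto simp: fam_def)

lemma sum_list_fam: "(\<Sum>p\<leftarrow>fam I L. f p) = (\<Sum>v<num_vertices I. f (v, L v))"
  by (simp add: fam_def comp_def sum_set_upt_conv_sum_list_nat[symmetric] atLeast0LessThan)

lemma score_fam: "score I (fam I L) u a = (\<Sum>v<num_vertices I. length (filter (adj I u a v) (L v)))"
  by (simp add: score_def sum_list_fam)

lemma total_score_fam: "total_score I (fam I L) = (\<Sum>u<num_vertices I. \<Sum>a\<leftarrow>L u. score I (fam I L) u a)"
  by (simp add: total_score_def sum_list_fam)

lemma refine_fam: "refine I (fam I L) u a = fam I (\<lambda>v. filter (adj I u a v) (L v))"
  by (simp add: refine_def fam_def)

lemma settle_fam: "settle I u (fam I L) =
    fam I (L(u := [response I (fam I L) u, response I (fam I L) u]))"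
  by (simp add: settle_def fam_def)

lemma response_less: "0 < alphabet I \<Longrightarrow> response I M u < alphabet I"
  using best_in[of "score I M u" "[0..<alphabet I]" 0] by (auto simp: response_def)

lemma response_ge: "a < alphabet I \<Longrightarrow> score I M u a \<le> score I M u (response I M u)"
  unfolding response_def by (rule best_ge) simp

text \<open>For a nonempty list the test admits exactly the indices below the quotient; for an empty
  list both sides are 0.\<close>

lemma length_filter_equalize:
  "length (filter P (concat (map (\<lambda>i. if Suc i * length xs \<le> q then xs else []) [0..<q]))) =
    (q div length xs) * length (filter P xs)"
proof (cases "xs = []")
  case False
  then have "(Suc i * length xs \<le> q) = (i < q div length xs)" for i
    by (metis Suc_le_eq length_greater_0_conv less_eq_div_iff_mult_less_eq)
  then have "length (filter P (concat (map (\<lambda>i. if Suc i * length xs \<le> q then xs else []) [0..<q]))) =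
      (\<Sum>i<q. if i < q div length xs then length (filter P xs) else 0)"
    by (simp add: filter_concat length_concat comp_def sum_set_upt_conv_sum_list_nat[symmetric]
        atLeast0LessThan if_distrib[of "filter P"] if_distrib[of length] cong: if_cong)
  also have "\<dots> = (\<Sum>i\<in>{..<q} \<inter> {i. i < q div length xs}. length (filter P xs))"
    by (simp only: sum.inter_restrict finite_lessThan mem_Collect_eq)
  also have "{..<q} \<inter> {i. i < q div length xs} = {..<q div length xs}"
    using div_le_dividend[of q "length xs"] by (auto intro: less_le_trans)
  finally show ?thesis by simp
qed simp

text \<open>Isolates what changes when only the label of \<open>u\<close> changes: by symmetry the
  row and the column of \<open>u\<close> contribute equally, and they overlap only in the zero
  diagonal entry.\<close>

lemma sum_sum_split:
  fixes s :: "nat \<Rightarrow> nat \<Rightarrow> nat"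
  assumes "u < n" "\<And>x y. s x y = s y x" "s u u = 0"
  shows "(\<Sum>x<n. \<Sum>y<n. s x y) = (\<Sum>x\<in>{..<n} - {u}. \<Sum>y\<in>{..<n} - {u}. s x y) + 2 * (\<Sum>y<n. s u y)"
proof -
  have 1: "(\<Sum>y<n. s x y) = s x u + (\<Sum>y\<in>{..<n} - {u}. s x y)" for x
    using assms(1) sum.remove[of "{..<n}" u "s x"] by simp
  have "(\<Sum>x<n. \<Sum>y<n. s x y) = (\<Sum>y<n. s u y) + (\<Sum>x\<in>{..<n} - {u}. \<Sum>y<n. s x y)"
    using assms(1) sum.remove[of "{..<n}" u "\<lambda>x. \<Sum>y<n. s x y"] by simp
  also have "(\<Sum>x\<in>{..<n} - {u}. \<Sum>y<n. s x y) =
      (\<Sum>x\<in>{..<n} - {u}. s u x) + (\<Sum>x\<in>{..<n} - {u}. \<Sum>y\<in>{..<n} - {u}. s x y)"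
    unfolding 1 by (simp add: sum.distrib assms(2)[of _ u])
  also have "(\<Sum>x\<in>{..<n} - {u}. s u x) = (\<Sum>y<n. s u y)" using 1[of u] assms(3) by simp
  finally show ?thesis by simp
qed

text \<open>A best response is at least as good as the average label of the list it replaces.\<close>

lemma total_score_settle:
  assumes I: "max_2csp I" and u: "u < num_vertices I"
    and L: "length (L u) = 2" "\<forall>a\<in>set (L u). a < alphabet I"
  shows "total_score I (fam I L) \<le> total_score I (settle I u (fam I L))"
proof -
  let ?n = "num_vertices I"
  define s where "s K x y = (\<Sum>a\<leftarrow>K x. length (filter (adj I x a y) (K y)))"
    for K :: "nat \<Rightarrow> nat list" and x y
  have total: "total_score I (fam I K) = (\<Sum>x<?n. \<Sum>y<?n. s K x y)" for K
  proof -
    have "(\<Sum>a\<leftarrow>xs. \<Sum>y<?n. f a y) = (\<Sum>y<?n. \<Sum>a\<leftarrow>xs. f a y)" for xs :: "nat list" and f :: "nat \<Rightarrow> nat \<Rightarrow> nat"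
      by (induction xs) (auto simp: sum.distrib)
    then show ?thesis by (simp add: total_score_fam score_fam s_def)
  qed
  have sym: "s K x y = s K y x" for K x y
  proof -
    have len: "length (filter P ys) = (\<Sum>b\<leftarrow>ys. of_bool (P b))" for P and ys :: "nat list"
      by (induction ys) auto
    have "(\<Sum>a\<leftarrow>xs. \<Sum>b\<leftarrow>ys. of_bool (adj I x a y b)) = (\<Sum>b\<leftarrow>ys. \<Sum>a\<leftarrow>xs. (of_bool (adj I y b x a) :: nat))" for xs ys
      by (induction xs) (auto simp: sum_list_addf adj_sym)
    then show ?thesis by (simp add: s_def len)
  qed
  have diag: "s K u u = 0" for K by (simp add: s_def adj_irrefl[OF I])
  define c where "c = response I (fam I L) u"
  define L' where "L' = L(u := [c, c])"
  obtain a b where ab: "L u = [a, b]"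
    using L(1) by (auto simp: numeral_2_eq_2 length_Suc_conv)
  have "(\<Sum>y<?n. s L u y) = score I (fam I L) u a + score I (fam I L) u b"
    by (simp add: s_def ab score_fam sum.distrib)
  also have "\<dots> \<le> score I (fam I L) u c + score I (fam I L) u c"
    using L(2) ab unfolding c_def by (intro add_mono response_ge) auto
  \<comment> \<open>\<open>L\<close> and \<open>L'\<close> differ only at \<open>u\<close>, and
    nodes of the same vertex are never adjacent.\<close>
  also have "\<dots> = (\<Sum>y<?n. s L' u y)"
    unfolding s_def score_fam sum.distrib[symmetric]
    by (intro sum.cong) (auto simp: L'_def adj_irrefl[OF I])
  finally have *: "(\<Sum>y<?n. s L u y) \<le> (\<Sum>y<?n. s L' u y)" .
  have "(\<Sum>x\<in>{..<?n} - {u}. \<Sum>y\<in>{..<?n} - {u}. s L x y) = (\<Sum>x\<in>{..<?n} - {u}. \<Sum>y\<in>{..<?n} - {u}. s L' x y)"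
    by (intro sum.cong) (auto simp: s_def L'_def)
  then show ?thesis
    unfolding settle_fam total c_def[symmetric] L'_def[symmetric]
    using * sum_sum_split[where s = "s L", OF u sym diag] sum_sum_split[where s = "s L'", OF u sym diag]
    by simp
qed

definition solution_family :: "csp \<Rightarrow> (nat \<Rightarrow> nat) \<Rightarrow> family" where
  "solution_family I \<phi> = fam I (\<lambda>v. [\<phi> v, \<phi> v])"

definition satisfied_pairs :: "csp \<Rightarrow> (nat \<Rightarrow> nat) \<Rightarrow> nat" where
  "satisfied_pairs I \<phi> = (\<Sum>u<num_vertices I. \<Sum>v<num_vertices I. of_bool (adj I u (\<phi> u) v (\<phi> v)))"

lemma total_score_solution: "total_score I (solution_family I \<phi>) = 4 * satisfied_pairs I \<phi>"
proof -
  let ?f = "\<lambda>u v. of_bool (adj I u (\<phi> u) v (\<phi> v)) :: nat"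
  have "length (filter (adj I u (\<phi> u) v) [\<phi> v, \<phi> v]) = 2 * ?f u v" for u v by simp
  then have "total_score I (solution_family I \<phi>) =
      (\<Sum>u<num_vertices I. 2 * (\<Sum>v<num_vertices I. 2 * ?f u v))"
    unfolding solution_family_def total_score_fam score_fam by simp
  also have "\<dots> = 4 * (\<Sum>u<num_vertices I. \<Sum>v<num_vertices I. ?f u v)"
    unfolding sum_distrib_left by (intro sum.cong refl) simp
  finally show ?thesis by (simp only: satisfied_pairs_def)
qed

text \<open>The method of conditional expectations: by \<open>total_score_settle\<close> no round
  lowers the score, and once all vertices are settled the family is a single assignment.
  \<open>M\<close> may be arbitrary, as \<open>two_labels\<close> takes nothing but responses from
  it.\<close>

lemma round_family_solution:
  assumes I: "max_2csp I"
  obtains \<phi> where "\<And>v. \<phi> v < alphabet I" "round_family I M = solution_family I \<phi>"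
    "total_score I (two_labels I (equalize I M)) \<le> total_score I (round_family I M)"
proof -
  let ?n = "num_vertices I" let ?q = "alphabet I"
  have q: "0 < ?q" using I by (simp add: max_2csp_def)
  define M' where "M' = equalize I M"
  define K where "K v = [response I M' v, response I (responses I M') v]" for v
  have K: "two_labels I M' = fam I K" by (simp add: two_labels_def fam_def K_def)
  have "\<exists>\<phi>. (\<forall>v. \<phi> v < ?q) \<and>
      fold (settle I) [0..<m] (fam I K) = fam I (\<lambda>v. if v < m then [\<phi> v, \<phi> v] else K v) \<and>
      total_score I (fam I K) \<le> total_score I (fold (settle I) [0..<m] (fam I K))"
    if "m \<le> ?n" for m
    using that
  proof (induction m)
    case 0
    show ?case using q by auto
  next
    case (Suc m)
    then obtain \<phi> where \<phi>: "\<forall>v. \<phi> v < ?q"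
      "fold (settle I) [0..<m] (fam I K) = fam I (\<lambda>v. if v < m then [\<phi> v, \<phi> v] else K v)"
      "total_score I (fam I K) \<le> total_score I (fold (settle I) [0..<m] (fam I K))" by auto
    let ?L = "\<lambda>v. if v < m then [\<phi> v, \<phi> v] else K v"
    let ?c = "response I (fam I ?L) m"
    have "fold (settle I) [0..<Suc m] (fam I K) = settle I m (fam I ?L)" by (simp add: \<phi>(2))
    moreover have "settle I m (fam I ?L) =
        fam I (\<lambda>v. if v < Suc m then [(\<phi>(m := ?c)) v, (\<phi>(m := ?c)) v] else K v)"
      unfolding settle_fam by (rule fam_cong) auto
    moreover have "total_score I (fam I ?L) \<le> total_score I (settle I m (fam I ?L))"
      using Suc.prems by (intro total_score_settle I) (auto simp: K_def response_less[OF q])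
    moreover have "\<forall>v. (\<phi>(m := ?c)) v < ?q" using \<phi>(1) response_less[OF q] by simp
    ultimately show ?case using \<phi>(2,3) by (intro exI[of _ "\<phi>(m := ?c)"]) simp
  qed
  from this[of ?n] obtain \<phi> where \<phi>: "\<forall>v. \<phi> v < ?q"
      "fold (settle I) [0..<?n] (fam I K) = fam I (\<lambda>v. if v < ?n then [\<phi> v, \<phi> v] else K v)"
      "total_score I (fam I K) \<le> total_score I (fold (settle I) [0..<?n] (fam I K))" by auto
  have "fam I (\<lambda>v. if v < ?n then [\<phi> v, \<phi> v] else K v) = solution_family I \<phi>"
    unfolding solution_family_def by (rule fam_cong) simp
  then show thesis
    using that[of \<phi>] \<phi> by (simp add: round_family_def M'_def[symmetric] K)
qed

text \<open>The left side is the expected number of compatible ordered pairs when u has label \<psi>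
  u and v draws from \<open>L v\<close>; an empty list contributes 0 / 0 = 0. Replacing \<psi> by
  \<alpha> and then the draws by \<beta> does not decrease the weighted count. Equalizing the
  lengths loses a factor 2, which is regained because \<open>X\<close> occurs twice in the score, as
  (\<alpha>, \<beta>) and as (\<beta>, \<alpha>).\<close>

lemma total_score_two_labels:
  assumes I: "max_2csp I" and L: "\<And>v b. b \<in> set (L v) \<Longrightarrow> b < alphabet I" "\<And>v. length (L v) \<le> alphabet I"
    and \<psi>: "\<And>v. v < num_vertices I \<Longrightarrow> \<psi> v < alphabet I"
  shows "(\<Sum>u<num_vertices I. \<Sum>v<num_vertices I. real (length (filter (adj I u (\<psi> u) v) (L v))) / real (length (L v)))
    \<le> real (total_score I (two_labels I (equalize I (fam I L))))"
proof -
  let ?n = "num_vertices I" let ?q = "alphabet I"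
  have q: "0 < ?q" using I by (simp add: max_2csp_def)
  define w where "w v = ?q div length (L v)" for v
  define M where "M = equalize I (fam I L)"
  define \<alpha> where "\<alpha> = response I M"
  define \<beta> where "\<beta> = response I (responses I M)"
  define X where "X = (\<Sum>v<?n. \<Sum>u<?n. of_bool (adj I v (\<beta> v) u (\<alpha> u)) :: nat)"
  have M: "M = fam I (\<lambda>v. concat (map (\<lambda>i. if Suc i * length (L v) \<le> ?q then L v else []) [0..<?q]))"
    by (simp add: M_def equalize_def fam_def cong: if_cong)
  have score_M: "score I M u a = (\<Sum>v<?n. w v * length (filter (adj I u a v) (L v)))" for u a
    unfolding M score_fam length_filter_equalize w_def ..
  have resp: "responses I M = fam I (\<lambda>u. [\<alpha> u])" by (simp add: responses_def fam_def \<alpha>_def)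
  have score_resp: "score I (responses I M) v b = (\<Sum>u<?n. of_bool (adj I v b u (\<alpha> u)))" for v b
    unfolding resp score_fam by (intro sum.cong) auto
  \<comment> \<open>The \<open>w v\<close> copies of \<open>L v\<close> have at most q entries in
    all, and against \<alpha> none of them scores more than \<beta> v.\<close>
  have step: "(\<Sum>u<?n. w v * length (filter (adj I u (\<alpha> u) v) (L v))) \<le>
      ?q * (\<Sum>u<?n. of_bool (adj I v (\<beta> v) u (\<alpha> u)))" for v
  proof -
    let ?s = "score I (responses I M) v"
    have "(\<Sum>u<?n. length (filter (adj I u (\<alpha> u) v) bs)) \<le> length bs * ?s (\<beta> v)"
      if "\<And>b. b \<in> set bs \<Longrightarrow> b < ?q" for bs
      using that
    proof (induction bs)
      case (Cons b bs)
      have "(\<Sum>u<?n. length (filter (adj I u (\<alpha> u) v) (b # bs))) =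
          ?s b + (\<Sum>u<?n. length (filter (adj I u (\<alpha> u) v) bs))"
        unfolding score_resp sum.distrib[symmetric] by (intro sum.cong) (auto simp: adj_sym)
      also have "\<dots> \<le> ?s (\<beta> v) + length bs * ?s (\<beta> v)"
        unfolding \<beta>_def using Cons by (intro add_mono response_ge) (auto simp: \<beta>_def)
      finally show ?case by simp
    qed simp
    then have "(\<Sum>u<?n. length (filter (adj I u (\<alpha> u) v) (L v))) \<le> length (L v) * ?s (\<beta> v)"
      using L(1) by blast
    then have "w v * (\<Sum>u<?n. length (filter (adj I u (\<alpha> u) v) (L v))) \<le> w v * (length (L v) * ?s (\<beta> v))"
      by simp
    also have "\<dots> \<le> ?q * ?s (\<beta> v)"
      unfolding mult.assoc[symmetric] by (intro mult_right_mono) (auto simp: w_def)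
    finally show ?thesis by (simp add: sum_distrib_left score_resp)
  qed
  have "(\<Sum>u<?n. \<Sum>v<?n. w v * length (filter (adj I u (\<psi> u) v) (L v))) \<le>
      (\<Sum>u<?n. \<Sum>v<?n. w v * length (filter (adj I u (\<alpha> u) v) (L v)))"
    unfolding score_M[symmetric] \<alpha>_def using \<psi> by (intro sum_mono response_ge) auto
  also have "\<dots> = (\<Sum>v<?n. \<Sum>u<?n. w v * length (filter (adj I u (\<alpha> u) v) (L v)))" by (rule sum.swap)
  also have "\<dots> \<le> ?q * X"
    unfolding X_def sum_distrib_left[of ?q] by (intro sum_mono step[unfolded sum_distrib_left])
  finally have wX: "(\<Sum>u<?n. \<Sum>v<?n. w v * length (filter (adj I u (\<psi> u) v) (L v))) \<le> ?q * X" .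
  \<comment> \<open>Rounding q / l down loses less than a factor 2, since l \<le> q makes the
    quotient at least 1.\<close>
  have w: "real ?q * (real l / real (length (L v))) \<le> 2 * real (w v * l)" for v l
  proof (cases "L v = []")
    case False
    then have len: "0 < length (L v)" "length (L v) \<le> ?q" using L(2) by auto
    then have "1 \<le> w v" by (simp add: w_def div_greater_zero_iff Suc_le_eq)
    have "?q < length (L v) * Suc (w v)" using dividend_less_times_div[of "length (L v)" ?q] len(1) by (simp add: w_def)
    also have "\<dots> \<le> length (L v) * (2 * w v)" using \<open>1 \<le> w v\<close> by (intro mult_left_mono) auto
    finally have "real ?q \<le> real (length (L v) * (2 * w v))" by linarith
    then have "real ?q * real l \<le> real (length (L v)) * (2 * w v) * real l" by (intro mult_right_mono) auto
    then show ?thesis using len(1) by (simp add: field_simps)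
  qed simp
  have "real ?q * (\<Sum>u<?n. \<Sum>v<?n. real (length (filter (adj I u (\<psi> u) v) (L v))) / real (length (L v))) \<le>
      2 * real (\<Sum>u<?n. \<Sum>v<?n. w v * length (filter (adj I u (\<psi> u) v) (L v)))"
    unfolding sum_distrib_left of_nat_sum by (intro sum_mono w)
  also have "\<dots> \<le> 2 * real (?q * X)" using wX by linarith
  finally have "(\<Sum>u<?n. \<Sum>v<?n. real (length (filter (adj I u (\<psi> u) v) (L v))) / real (length (L v))) \<le> 2 * real X"
    using q by simp
  moreover have "2 * X \<le> total_score I (two_labels I M)"
  proof -
    have "two_labels I M = fam I (\<lambda>u. [\<alpha> u, \<beta> u])" by (simp add: two_labels_def fam_def \<alpha>_def \<beta>_def)
    then have "total_score I (two_labels I M) = (\<Sum>u<?n. score I (fam I (\<lambda>u. [\<alpha> u, \<beta> u])) u (\<alpha> u)) +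
        (\<Sum>u<?n. score I (fam I (\<lambda>u. [\<alpha> u, \<beta> u])) u (\<beta> u))"
      by (simp add: total_score_fam sum.distrib)
    also have "\<dots> \<ge> X + X"
    proof (intro add_mono)
      have "X = (\<Sum>u<?n. \<Sum>v<?n. of_bool (adj I u (\<alpha> u) v (\<beta> v)))"
        unfolding X_def by (subst sum.swap) (simp add: adj_sym)
      also have "\<dots> \<le> (\<Sum>u<?n. score I (fam I (\<lambda>u. [\<alpha> u, \<beta> u])) u (\<alpha> u))"
        unfolding score_fam by (intro sum_mono) auto
      finally show "X \<le> (\<Sum>u<?n. score I (fam I (\<lambda>u. [\<alpha> u, \<beta> u])) u (\<alpha> u))" .
      show "X \<le> (\<Sum>u<?n. score I (fam I (\<lambda>u. [\<alpha> u, \<beta> u])) u (\<beta> u))"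
        unfolding X_def score_fam by (intro sum_mono) auto
    qed
    finally show ?thesis by simp
  qed
  ultimately show ?thesis unfolding M_def by linarith
qed

section \<open>Guarantee of the search\<close>

lemma search_solution:
  assumes I: "max_2csp I"
  obtains \<phi> where "\<And>v. \<phi> v < alphabet I" "search d I M = solution_family I \<phi>"
proof -
  have "\<exists>\<phi>. (\<forall>v. \<phi> v < alphabet I) \<and> search d I M = solution_family I \<phi>"
  proof (induction d arbitrary: M)
    case 0
    show ?case using round_family_solution[OF I, of M] by auto
  next
    case (Suc d)
    let ?in = "\<lambda>N. \<exists>\<phi>. (\<forall>v. \<phi> v < alphabet I) \<and> N = solution_family I \<phi>"
    have *: "?in (best f Ns N)" if "\<And>N'. N' \<in> set Ns \<Longrightarrow> ?in N'" "?in N" for f Ns N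
      using best_in[of f Ns N] that by auto
    have R: "?in (round_family I M)" using round_family_solution[OF I, of M] by metis
    have S: "?in (search d I N)" for N using Suc by blast
    have "?in (best f (map (\<lambda>a. search d I (N a)) as) (round_family I M))" for f N and as :: "nat list"
      by (rule *[OF _ R]) (use S in auto)
    then show ?case unfolding search.simps by (intro *[OF _ R]) auto
  qed
  then show thesis using that by blast
qed

lemma search_ge:
  assumes "length ts \<le> d" "\<forall>(u, a)\<in>set ts. u < num_vertices I \<and> a < alphabet I"
  shows "total_score I (round_family I (fold (\<lambda>(u, a) N. refine I N u a) ts M)) \<le> total_score I (search d I M)"
  using assms
proof (induction d arbitrary: ts M)
  case (Suc d)
  let ?f = "total_score I"
  define N where "N = (\<lambda>u. best ?f (map (\<lambda>a. search d I (refine I M u a)) [0..<alphabet I]) (round_family I M))"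
  have search: "search (Suc d) I M = best ?f (map N [0..<num_vertices I]) (round_family I M)"
    by (simp add: N_def)
  show ?case
  proof (cases ts)
    case Nil
    then show ?thesis unfolding search by (auto intro: best_ge)
  next
    case (Cons t ts')
    obtain u a where t: "t = (u, a)" by force
    have ua: "u < num_vertices I" "a < alphabet I" using Suc.prems Cons t by auto
    have "?f (round_family I (fold (\<lambda>(u, a) N. refine I N u a) ts M)) \<le> ?f (search d I (refine I M u a))"
      using Suc.IH[of ts' "refine I M u a"] Suc.prems Cons t by simp
    also have "\<dots> \<le> ?f (N u)" unfolding N_def using ua by (intro best_ge) auto
    also have "\<dots> \<le> ?f (search (Suc d) I M)" unfolding search using ua by (intro best_ge) auto
    finally show ?thesis .
  qed
qed simp

definition candidates :: "csp \<Rightarrow> (nat \<Rightarrow> nat) \<Rightarrow> nat list \<Rightarrow> nat \<Rightarrow> nat list" where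
  "candidates I \<psi> us v = filter (\<lambda>b. \<forall>u\<in>set us. adj I u (\<psi> u) v b) [0..<alphabet I]"

lemma refine_candidates:
  "fold (\<lambda>(u, a) N. refine I N u a) (map (\<lambda>u. (u, \<psi> u)) us) (full_family I) = fam I (candidates I \<psi> us)"
proof (induction us rule: rev_induct)
  case Nil
  show ?case by (simp add: full_family_def candidates_def fam_def)
next
  case (snoc u us)
  then show ?case
    by (auto simp: refine_fam candidates_def intro!: fam_cong filter_cong)
qed

text \<open>The algorithm does not know \<psi>, but the nodes \<open>(u, \<psi> u)\<close> for
  \<open>u\<close> in \<open>us\<close> form one of the tuples it tries, and its result scores at
  least as much as the rounding for that tuple. The 4 comes from the doubled labels at both
  ends.\<close>

lemma satisfied_pairs_search:
  assumes I: "max_2csp I" and \<psi>: "\<And>v. v < num_vertices I \<Longrightarrow> \<psi> v < alphabet I"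
    and us: "length us \<le> d" "set us \<subseteq> {..<num_vertices I}"
    and \<phi>: "search d I (full_family I) = solution_family I \<phi>"
  shows "(\<Sum>u<num_vertices I. \<Sum>v<num_vertices I.
      real (length (candidates I \<psi> (us @ [u]) v)) / real (length (candidates I \<psi> us v)))
    \<le> 4 * real (satisfied_pairs I \<phi>)"
proof -
  let ?M = "fam I (candidates I \<psi> us)"
  have filter: "filter (adj I u (\<psi> u) v) (candidates I \<psi> us v) = candidates I \<psi> (us @ [u]) v" for u v
    by (auto simp: candidates_def intro!: filter_cong)
  have "length (candidates I \<psi> us v) \<le> alphabet I" for v
    unfolding candidates_def by (rule order_trans[OF length_filter_le]) simp
  then have "(\<Sum>u<num_vertices I. \<Sum>v<num_vertices I.
      real (length (filter (adj I u (\<psi> u) v) (candidates I \<psi> us v))) / real (length (candidates I \<psi> us v)))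
    \<le> real (total_score I (two_labels I (equalize I ?M)))"
    using \<psi> by (intro total_score_two_labels I) (auto simp: candidates_def)
  also have "\<dots> \<le> real (total_score I (round_family I ?M))"
    using round_family_solution[OF I, of ?M] by fastforce
  also have "\<dots> \<le> real (total_score I (search d I (full_family I)))"
    using search_ge[of "map (\<lambda>u. (u, \<psi> u)) us" d I "full_family I"] us \<psi>
    unfolding refine_candidates by auto
  also have "\<dots> = 4 * real (satisfied_pairs I \<phi>)" by (simp add: \<phi> total_score_solution)
  finally show ?thesis unfolding filter .
qed

section \<open>Existence of a good family\<close>

text \<open>
  \<open>L us v\<close> is the number of candidates of \<open>v\<close>. A vertex whose list is shorter than \<open>\<theta>\<close> to the power
  \<open>-j\<close> cannot lose a factor \<open>\<theta>\<close> in each of \<open>j\<close> steps, so each of its \<open>d v ^ j\<close> continuations has a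
  step that keeps at least the fraction \<open>\<theta>\<close> of the list.
\<close>

lemma sum_degree_power_le:
  fixes R :: "nat \<Rightarrow> nat \<Rightarrow> bool" and L :: "nat list \<Rightarrow> nat \<Rightarrow> real" and \<theta> B :: real
  assumes L: "\<And>us v. v < n \<Longrightarrow> \<forall>u\<in>set us. R u v \<Longrightarrow> 1 \<le> L us v"
    and \<theta>: "0 < \<theta>"
    and B: "\<And>us. set us \<subseteq> {..<n} \<Longrightarrow> length us < k \<Longrightarrow>
      real (card {(u, v). u < n \<and> v < n \<and> (\<forall>x\<in>set us. R x v) \<and> R u v \<and> \<theta> * L us v \<le> L (us @ [u]) v}) \<le> B"
  defines "d \<equiv> \<lambda>v. card {u. u < n \<and> R u v}"
  assumes "set us \<subseteq> {..<n}" "length us + j \<le> k"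
  shows "(\<Sum>v | v < n \<and> (\<forall>u\<in>set us. R u v) \<and> L us v * \<theta> ^ j < 1. real (d v) ^ j) \<le> real j * real n ^ (j - 1) * B"
  using assms(5,6)
proof (induction j arbitrary: us)
  case 0
  \<comment> \<open>A compatible vertex has \<open>1 \<le> L us v\<close>, so with no steps left no
    vertex qualifies.\<close>
  have "{v. v < n \<and> (\<forall>u\<in>set us. R u v) \<and> L us v * \<theta> ^ 0 < 1} = {}" using L[of _ us] by force
  then show ?case by (simp only: sum.empty)
next
  case (Suc j)
  let ?A = "{v. v < n \<and> (\<forall>u\<in>set us. R u v) \<and> L us v * \<theta> ^ Suc j < 1}"
  let ?P = "{(u, v). u < n \<and> v < n \<and> (\<forall>x\<in>set us. R x v) \<and> R u v \<and> \<theta> * L us v \<le> L (us @ [u]) v}"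
  let ?A' = "\<lambda>u. {v. v < n \<and> (\<forall>x\<in>set (us @ [u]). R x v) \<and> L (us @ [u]) v * \<theta> ^ j < 1}"
  have dn: "d v \<le> n" for v
    using card_mono[of "{..<n}" "{u. u < n \<and> R u v}"] by (auto simp: d_def)
  have finP: "finite ?P" by (rule finite_subset[of _ "{..<n} \<times> {..<n}"]) auto
  have "0 \<le> B" using B[of us] Suc.prems by (auto intro: order_trans[OF of_nat_0_le_iff])
  \<comment> \<open>One factor \<open>d v\<close> is spent on the choice of the next
    \<open>u\<close>. Each resulting pair either keeps the fraction \<theta> and lies in
    \<open>?P\<close>, or its list shrinks enough for the induction hypothesis at
    \<open>us @ [u]\<close>.\<close>
  have "(\<Sum>v\<in>?A. real (d v) ^ Suc j) = (\<Sum>v\<in>?A. \<Sum>u | u < n \<and> R u v. real (d v) ^ j)"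
    by (simp only: sum_constant power_Suc d_def)
  also have "\<dots> = (\<Sum>(v, u)\<in>(SIGMA v:?A. {u. u < n \<and> R u v}). real (d v) ^ j)"
    by (rule sum.Sigma) auto
  also have "\<dots> = (\<Sum>(u, v)\<in>{(u, v). v \<in> ?A \<and> u < n \<and> R u v}. real (d v) ^ j)"
    by (rule sum.reindex_bij_witness[of _ prod.swap prod.swap]) auto
  also have "\<dots> \<le> (\<Sum>(u, v)\<in>?P \<union> (SIGMA u:{..<n}. ?A' u). real (d v) ^ j)"
  proof (rule sum_mono2)
    show "{(u, v). v \<in> ?A \<and> u < n \<and> R u v} \<subseteq> ?P \<union> (SIGMA u:{..<n}. ?A' u)"
    proof
      fix p assume p: "p \<in> {(u, v). v \<in> ?A \<and> u < n \<and> R u v}"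
      obtain u v where uv: "p = (u, v)" by force
      have v: "v < n" "\<forall>u\<in>set us. R u v" "L us v * \<theta> ^ Suc j < 1" "u < n" "R u v"
        using p uv by auto
      show "p \<in> ?P \<union> (SIGMA u:{..<n}. ?A' u)"
      proof (cases "\<theta> * L us v \<le> L (us @ [u]) v")
        case True
        then show ?thesis using v uv by simp
      next
        case False
        then have "L (us @ [u]) v * \<theta> ^ j \<le> \<theta> * L us v * \<theta> ^ j" using \<theta> by (intro mult_right_mono) auto
        also have "\<dots> < 1" using v(3) by (simp add: mult.commute mult.left_commute)
        finally show ?thesis using v uv by simp
      qed
    qed
    show "finite (?P \<union> (SIGMA u:{..<n}. ?A' u))" using finP by auto
  qed auto
  also have "\<dots> \<le> (\<Sum>(u, v)\<in>?P. real (d v) ^ j) + (\<Sum>(u, v)\<in>(SIGMA u:{..<n}. ?A' u). real (d v) ^ j)"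
  proof -
    have fin: "finite (SIGMA u:{..<n}. ?A' u)" by auto
    show ?thesis using sum.union_inter[OF finP fin, of "\<lambda>(u, v). real (d v) ^ j"]
        sum_nonneg[of "?P \<inter> (SIGMA u:{..<n}. ?A' u)" "\<lambda>(u, v). real (d v) ^ j"] by auto
  qed
  also have "(\<Sum>(u, v)\<in>?P. real (d v) ^ j) \<le> real n ^ j * B"
  proof -
    have "(\<Sum>(u, v)\<in>?P. real (d v) ^ j) \<le> (\<Sum>_\<in>?P. real n ^ j)"
      using dn by (intro sum_mono) (auto intro!: power_mono)
    also have "\<dots> = real n ^ j * real (card ?P)" by simp
    also have "\<dots> \<le> real n ^ j * B" using B[of us] Suc.prems by (intro mult_left_mono) auto
    finally show ?thesis .
  qed
  also have "(\<Sum>(u, v)\<in>(SIGMA u:{..<n}. ?A' u). real (d v) ^ j) = (\<Sum>u<n. \<Sum>v\<in>?A' u. real (d v) ^ j)"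
    by (rule sum.Sigma[symmetric]) auto
  also have "\<dots> \<le> (\<Sum>u<n. real j * real n ^ (j - 1) * B)"
  proof (rule sum_mono)
    fix u assume "u \<in> {..<n}"
    then show "(\<Sum>v\<in>?A' u. real (d v) ^ j) \<le> real j * real n ^ (j - 1) * B"
      using Suc.IH[of "us @ [u]"] Suc.prems by simp
  qed
  \<comment> \<open>At \<open>j = 0\<close> the truncated exponent \<open>j - 1\<close> is harmless,
    because the factor \<open>j\<close> vanishes.\<close>
  also have "\<dots> = real j * real n ^ j * B" by (cases j) auto
  finally show ?case by (simp add: algebra_simps)
qed

text \<open>The average degree is 2m. Vertices of degree below m account for at most half of the
  total and the others have degree at most n, so at least m vertices have degree at least m. This is
  cruder than convexity but elementary.\<close>

lemma sum_power_ge: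
  fixes d :: "nat \<Rightarrow> nat" and m :: real
  assumes d: "\<And>v. v < n \<Longrightarrow> d v \<le> n" and m: "0 \<le> m" "(\<Sum>v<n. real (d v)) = 2 * m * real n" and n: "0 < n"
  shows "m ^ Suc k \<le> (\<Sum>v<n. real (d v) ^ k)"
proof -
  let ?H = "{v \<in> {..<n}. m \<le> real (d v)}"
  have "(\<Sum>v<n. real (d v)) \<le> (\<Sum>v<n. real n * of_bool (m \<le> real (d v)) + m)"
  proof (rule sum_mono)
    fix v assume "v \<in> {..<n}"
    then have "real (d v) \<le> real n" using d by simp
    then show "real (d v) \<le> real n * of_bool (m \<le> real (d v)) + m" using m(1) by simp
  qed
  also have "\<dots> = real n * real (card ?H) + m * real n"
  proof -
    have "?H = {..<n} \<inter> {v. m \<le> real (d v)}" by auto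
    then show ?thesis by (simp add: sum.distrib sum_distrib_left[symmetric])
  qed
  finally have "real n * m \<le> real n * real (card ?H)" using m(2) by (simp add: algebra_simps)
  then have H: "m \<le> real (card ?H)" using n by simp
  have "m ^ Suc k \<le> real (card ?H) * m ^ k" using H m(1) by (simp add: mult_right_mono)
  also have "\<dots> = (\<Sum>v\<in>?H. m ^ k)" by simp
  also have "\<dots> \<le> (\<Sum>v\<in>?H. real (d v) ^ k)" using m(1) by (intro sum_mono power_mono) auto
  also have "\<dots> \<le> (\<Sum>v<n. real (d v) ^ k)" by (intro sum_mono2) auto
  finally show ?thesis .
qed

section \<open>Edges and ordered pairs\<close>

lemma max_2csp_edge:
  assumes "max_2csp I" "(u, v) \<in> edges I"
  shows "u < num_vertices I" "v < num_vertices I" "(v, u) \<notin> edges I"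
proof -
  have "\<forall>(u, v)\<in>edges I. u < num_vertices I \<and> v < num_vertices I \<and> u \<noteq> v \<and> (v, u) \<notin> edges I"
    using assms(1) unfolding max_2csp_def by blast
  from bspec[OF this assms(2)]
  show "u < num_vertices I" "v < num_vertices I" "(v, u) \<notin> edges I" by simp_all
qed

text \<open>A satisfied edge is compatible in both orders while \<open>edges\<close> stores just one
  of them. Labels have to be in range because \<open>holds\<close> demands it.\<close>

lemma card_satisfied:
  assumes I: "max_2csp I" and \<phi>: "\<And>v. v < num_vertices I \<Longrightarrow> \<phi> v < alphabet I"
  shows "satisfied_pairs I \<phi> = 2 * card {(u, v) \<in> edges I. constraint I (u, v) (\<phi> u) (\<phi> v)}"
proof -
  let ?n = "num_vertices I"
  let ?S = "{(u, v) \<in> edges I. constraint I (u, v) (\<phi> u) (\<phi> v)}"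
  have E: "u < ?n" "v < ?n" "(v, u) \<notin> edges I" if "(u, v) \<in> edges I" for u v
    using max_2csp_edge[OF I that] .
  have "finite ?S" by (rule finite_subset[of _ "{..<?n} \<times> {..<?n}"]) (use E(1,2) in fast, simp)
  have "satisfied_pairs I \<phi> = (\<Sum>(u, v)\<in>{..<?n} \<times> {..<?n}. of_bool (adj I u (\<phi> u) v (\<phi> v)))"
    unfolding satisfied_pairs_def by (rule sum.cartesian_product)
  also have "\<dots> = (\<Sum>p\<in>{..<?n} \<times> {..<?n}. of_bool (p \<in> {(u, v). adj I u (\<phi> u) v (\<phi> v)}))"
    by (rule sum.cong) auto
  also have "\<dots> = card (({..<?n} \<times> {..<?n}) \<inter> {(u, v). adj I u (\<phi> u) v (\<phi> v)})"
    by (simp only: sum_of_bool_eq finite_cartesian_product finite_lessThan Collect_mem_eq of_nat_id)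
  also have "({..<?n} \<times> {..<?n}) \<inter> {(u, v). adj I u (\<phi> u) v (\<phi> v)} = ?S \<union> prod.swap ` ?S"
  proof -
    have iff: "u < ?n \<and> v < ?n \<and> adj I u (\<phi> u) v (\<phi> v) \<longleftrightarrow> (u, v) \<in> ?S \<or> (v, u) \<in> ?S" for u v
      using E(1,2)[of u v] E(1,2)[of v u] \<phi>[of u] \<phi>[of v] unfolding adj_def holds_def by blast
    show ?thesis
    proof (rule set_eqI)
      fix p :: "nat \<times> nat"
      obtain u v where "p = (u, v)" by force
      then show "p \<in> ({..<?n} \<times> {..<?n}) \<inter> {(u, v). adj I u (\<phi> u) v (\<phi> v)} \<longleftrightarrow> p \<in> ?S \<union> prod.swap ` ?S"
        using iff[of u v] unfolding Un_iff Int_iff by (simp only: pair_in_swap_image mem_Times_iff fst_conv snd_conv lessThan_iff mem_Collect_eq case_prod_conv conj_assoc)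
    qed
  qed
  also have "card \<dots> = card ?S + card (prod.swap ` ?S)"
  proof (rule card_Un_disjoint)
    have "(u, v) \<notin> prod.swap ` ?S" if "(u, v) \<in> ?S" for u v
      using E(3)[of u v] that unfolding pair_in_swap_image by blast
    then show "?S \<inter> prod.swap ` ?S = {}" by fast
  qed (simp_all add: \<open>finite ?S\<close>)
  also have "card (prod.swap ` ?S) = card ?S" by (rule card_image) simp
  finally show ?thesis by simp
qed

lemma double_card_edges_le:
  assumes "max_2csp I"
  shows "2 * card (edges I) \<le> num_vertices I ^ 2"
proof -
  let ?n = "num_vertices I" let ?E = "edges I"
  have E: "u < ?n" "v < ?n" "(v, u) \<notin> ?E" if "(u, v) \<in> ?E" for u v
    using max_2csp_edge[OF assms that] .
  have fin: "finite ?E" by (rule finite_subset[of _ "{..<?n} \<times> {..<?n}"]) (use E(1,2) in fast, simp)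
  have "card ?E + card (prod.swap ` ?E) = card (?E \<union> prod.swap ` ?E)"
  proof (rule card_Un_disjoint[symmetric])
    have "(u, v) \<notin> prod.swap ` ?E" if "(u, v) \<in> ?E" for u v
      using E(3) that unfolding pair_in_swap_image by blast
    then show "?E \<inter> prod.swap ` ?E = {}" by fast
  qed (simp_all add: fin)
  also have "\<dots> \<le> card ({..<?n} \<times> {..<?n})" using E(1,2) by (intro card_mono) auto
  finally show ?thesis by (simp add: card_image power2_eq_square)
qed

text \<open>If every tuple of fewer than k vertices had at most \<open>B\<close> pairs that keep the
  fraction \<theta>, then \<open>sum_degree_power_le\<close> for the empty tuple would bound the sum
  of all k-th powers of degrees below the value given by \<open>sum_power_ge\<close>. For a tuple
  with more such pairs, each of them contributes at least \<theta> to the expectation that the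
  rounding achieves.\<close>

lemma satisfied_pairs_ge:
  fixes \<rho> :: real
  assumes I: "max_2csp I" and \<psi>: "\<And>v. v < num_vertices I \<Longrightarrow> \<psi> v < alphabet I"
    and \<phi>: "search d I (full_family I) = solution_family I \<phi>"
    and \<rho>: "real (satisfied_pairs I \<psi>) = 2 * \<rho> * real (num_vertices I) ^ 2" "0 < \<rho>"
  shows "\<rho> ^ (d + 2) * real (alphabet I) powr (- (1 / real (Suc d))) * real (num_vertices I) ^ 2
    \<le> 16 * real (Suc d) * real (satisfied_pairs I \<phi>)"
proof -
  let ?n = "num_vertices I" let ?q = "alphabet I" let ?k = "Suc d"
  have q: "0 < ?q" and n: "0 < ?n" using I by (auto simp: max_2csp_def)
  define R where "R u v \<longleftrightarrow> adj I u (\<psi> u) v (\<psi> v)" for u v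
  define L where "L us v = real (length (candidates I \<psi> us v))" for us v
  \<comment> \<open>The 2 makes q times \<open>\<theta> ^ ?k\<close> equal to 1/2, strictly below 1,
    so that every vertex satisfies the strict condition in
    \<open>sum_degree_power_le\<close>.\<close>
  define \<theta> where "\<theta> = (2 * real ?q) powr (- (1 / real ?k))"
  \<comment> \<open>Chosen so that the bound \<open>?k * ?n ^ (?k - 1) * B\<close> is half of
    \<open>(\<rho> * ?n) ^ Suc ?k\<close>.\<close>
  define B where "B = \<rho> ^ Suc ?k * real ?n ^ 2 / (2 * real ?k)"
  let ?d = "\<lambda>v. card {u. u < ?n \<and> R u v}"
  let ?P = "\<lambda>us. {(u, v). u < ?n \<and> v < ?n \<and> (\<forall>x\<in>set us. R x v) \<and> R u v \<and>
    \<theta> * L us v \<le> L (us @ [u]) v}"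
  have \<theta>: "0 < \<theta>" using q by (simp add: \<theta>_def)
  have "\<theta> ^ ?k = (2 * real ?q) powr (real ?k * - (1 / real ?k))"
    unfolding \<theta>_def by (rule powr_power) (use q in simp)
  then have \<theta>k: "\<theta> ^ ?k = 1 / (2 * real ?q)" using q by (simp add: powr_minus divide_simps)
  have L_ge: "1 \<le> L us v" if "v < ?n" "\<forall>u\<in>set us. R u v" for us v
  proof -
    have "\<psi> v \<in> set (candidates I \<psi> us v)" using that \<psi> by (auto simp: candidates_def R_def)
    then show ?thesis unfolding L_def by (cases "candidates I \<psi> us v") auto
  qed
  have d_sum: "(\<Sum>v<?n. real (?d v)) = 2 * (\<rho> * real ?n) * real ?n"
  proof -
    have "?d v = (\<Sum>u<?n. of_bool (R u v))" for v
    proof -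
      have "{u. u < ?n \<and> R u v} = {..<?n} \<inter> {u. R u v}" by auto
      then show ?thesis by simp
    qed
    then have "(\<Sum>v<?n. ?d v) = satisfied_pairs I \<psi>"
      unfolding satisfied_pairs_def R_def by (simp only: adj_sym)
    then show ?thesis using \<rho> by (simp add: of_nat_sum[symmetric] power2_eq_square)
  qed
  have "?d v \<le> ?n" for v using card_mono[of "{..<?n}" "{u. u < ?n \<and> R u v}"] by auto
  then have lower: "(\<rho> * real ?n) ^ Suc ?k \<le> (\<Sum>v<?n. real (?d v) ^ ?k)"
    using d_sum \<rho>(2) n by (intro sum_power_ge) auto
  have "\<exists>us. set us \<subseteq> {..<?n} \<and> length us < ?k \<and> B < real (card (?P us))"
  proof (rule ccontr)
    assume "\<not> ?thesis"
    then have B: "real (card (?P us)) \<le> B" if "set us \<subseteq> {..<?n}" "length us < ?k" for us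
      using that by force
    have "{v. v < ?n \<and> (\<forall>u\<in>set []. R u v) \<and> L [] v * \<theta> ^ ?k < 1} = {..<?n}"
      using q unfolding \<theta>k by (auto simp: L_def candidates_def)
    then have "(\<Sum>v<?n. real (?d v) ^ ?k) \<le> real ?k * real ?n ^ (?k - 1) * B"
      using sum_degree_power_le[where us = "[]" and j = ?k and k = ?k and R = R and L = L, OF L_ge \<theta> B] by simp
    also have "\<dots> = \<rho> ^ Suc ?k * real ?n ^ Suc ?k / 2"
      by (simp add: B_def power2_eq_square field_simps)
    also have "\<dots> < (\<rho> * real ?n) ^ Suc ?k"
      using \<rho>(2) n by (simp add: power_mult_distrib)
    finally show False using lower by simp
  qed
  then obtain us where us: "set us \<subseteq> {..<?n}" "length us < ?k" "B < real (card (?P us))" by blast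
  have "\<theta> * B \<le> \<theta> * real (card (?P us))" using us(3) \<theta> by simp
  also have "\<dots> = (\<Sum>(u, v)\<in>?P us. \<theta>)" by simp
  also have "\<dots> \<le> (\<Sum>(u, v)\<in>?P us. L (us @ [u]) v / L us v)"
  proof (rule sum_mono)
    fix p assume p: "p \<in> ?P us"
    obtain u v where [simp]: "p = (u, v)" by force
    show "(case p of (u, v) \<Rightarrow> \<theta>) \<le> (case p of (u, v) \<Rightarrow> L (us @ [u]) v / L us v)"
      using p L_ge[of v us] by (simp add: le_divide_eq)
  qed
  also have "\<dots> \<le> (\<Sum>(u, v)\<in>{..<?n} \<times> {..<?n}. L (us @ [u]) v / L us v)"
    by (rule sum_mono2) (auto simp: L_def)
  also have "\<dots> = (\<Sum>u<?n. \<Sum>v<?n. L (us @ [u]) v / L us v)" by (rule sum.cartesian_product[symmetric])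
  also have "\<dots> \<le> 4 * real (satisfied_pairs I \<phi>)"
    unfolding L_def using us by (intro satisfied_pairs_search[OF I \<psi> _ _ \<phi>]) auto
  finally have *: "\<theta> * B \<le> 4 * real (satisfied_pairs I \<phi>)" .
  \<comment> \<open>Here the 2 in \<theta> is paid for: its k-th root is at most 2.\<close>
  have "real ?q powr (- (1 / real ?k)) \<le> 2 * \<theta>"
  proof -
    have "(2::real) powr (1 / real ?k) \<le> 2 powr 1" by (intro powr_mono) auto
    then have "1 \<le> 2 * (2::real) powr (- (1 / real ?k))" by (simp add: powr_minus field_simps)
    then have "1 * real ?q powr (- (1 / real ?k)) \<le> 2 * 2 powr (- (1 / real ?k)) * real ?q powr (- (1 / real ?k))"
      by (intro mult_right_mono) auto
    then show ?thesis by (simp add: \<theta>_def powr_mult)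
  qed
  then have "\<rho> ^ Suc ?k * real ?n ^ 2 * real ?q powr (- (1 / real ?k)) \<le> \<rho> ^ Suc ?k * real ?n ^ 2 * (2 * \<theta>)"
    using \<rho>(2) by (intro mult_left_mono) auto
  also have "\<dots> = 4 * real ?k * (\<theta> * B)"
    by (simp add: B_def del: of_nat_Suc power_Suc)
  also have "\<dots> \<le> 4 * real ?k * (4 * real (satisfied_pairs I \<phi>))" using * by (intro mult_left_mono) auto
  finally show ?thesis by (simp add: mult_ac)
qed

section \<open>The bound on the value\<close>

lemma csp_value_attained:
  assumes "max_2csp I"
  obtains \<psi> where "\<psi> \<in> assignments I" "csp_value I = assignment_value I \<psi>"
proof -
  have "finite (assignments I)" unfolding assignments_def by (intro finite_PiE) auto
  moreover have "assignments I \<noteq> {}"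
    using assms unfolding assignments_def max_2csp_def by (auto simp: PiE_eq_empty_iff)
  ultimately have "csp_value I \<in> assignment_value I ` assignments I"
    unfolding csp_value_def by (intro Max_in) auto
  then show thesis using that by blast
qed

text \<open>It remains to turn a bound that depends on k into one with constants valid for all
  \<gamma>. The 16 is the one of \<open>satisfied_pairs_ge\<close>; its factor k is moved into the
  power of \<rho>.\<close>

lemma assignment_value_solve_ge:
  fixes \<gamma> :: real
  assumes I: "max_2csp I" and \<gamma>: "0 < \<gamma>" and d: "Suc d = nat \<lceil>1 / \<gamma>\<rceil>"
    and \<phi>: "search d I (full_family I) = solution_family I \<phi>" "\<And>v. \<phi> v < alphabet I"
  shows "1 / 16 * ((density I * csp_value I) powr (8 / \<gamma>) * real (num_vertices I * alphabet I) powr (- \<gamma>))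
    \<le> assignment_value I \<phi>"
proof -
  let ?n = "num_vertices I" let ?q = "alphabet I" let ?k = "Suc d"
  obtain \<psi> where \<psi>: "\<psi> \<in> assignments I" "csp_value I = assignment_value I \<psi>"
    using csp_value_attained[OF I] by blast
  have \<psi>q: "\<psi> v < ?q" if "v < ?n" for v using \<psi>(1) that by (auto simp: assignments_def PiE_iff)
  have q: "1 \<le> ?q" and n: "1 \<le> ?n" using I by (auto simp: max_2csp_def)
  define e where "e = real (card (edges I))"
  define \<rho> where "\<rho> = density I * csp_value I"
  define N where "N = real (?n * ?q)"
  have N: "1 \<le> N" "real ?n \<le> N" "real ?q \<le> N"
    using q n by (auto simp: N_def simp flip: of_nat_mult)
  have pairs_eq: "2 * e * assignment_value I \<chi> = real (satisfied_pairs I \<chi>)"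
    if "\<And>v. v < ?n \<Longrightarrow> \<chi> v < ?q" "e \<noteq> 0" for \<chi>
    using card_satisfied[OF I that(1)] that(2) by (simp add: assignment_value_def e_def)
  have value_nonneg: "0 \<le> assignment_value I \<chi>" for \<chi> by (simp add: assignment_value_def)
  have "0 \<le> \<rho>" by (simp add: \<rho>_def density_def \<psi>(2) value_nonneg)
  show ?thesis
  proof (cases "\<rho> = 0")
    \<comment> \<open>This includes instances without edges. As \<open>0 powr x = 0\<close>, the
      claimed bound is 0.\<close>
    case True
    then show ?thesis using value_nonneg[of \<phi>] unfolding \<rho>_def by (simp only: powr_def simp_thms if_True mult_zero_left mult_zero_right)
  next
    case False
    then have \<rho>: "0 < \<rho>" using \<open>0 \<le> \<rho>\<close> by simp
    then have e: "0 < e" unfolding \<rho>_def density_def e_def by (cases "card (edges I) = 0") auto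
    have e_le: "2 * e \<le> real ?n ^ 2"
      using double_card_edges_le[OF I] unfolding e_def by (simp flip: of_nat_power)
    have sat: "real (satisfied_pairs I \<psi>) = 2 * \<rho> * real ?n ^ 2"
      using pairs_eq[of \<psi>, OF \<psi>q] e n by (simp add: \<rho>_def density_def \<psi>(2) e_def)
    have "satisfied_pairs I \<psi> \<le> (\<Sum>u<?n. \<Sum>v<?n. 1)"
      unfolding satisfied_pairs_def by (intro sum_mono) auto
    then have "real (satisfied_pairs I \<psi>) \<le> real (?n * ?n)" by (simp only: of_nat_le_iff) simp
    then have "2 * \<rho> * real ?n ^ 2 \<le> 1 * real ?n ^ 2" unfolding sat by (simp add: power2_eq_square)
    then have \<rho>_le: "2 * \<rho> \<le> 1" using n by simp
    have main: "\<rho> ^ (d + 2) * real ?q powr (- (1 / real ?k)) * real ?n ^ 2 \<le>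
        16 * real ?k * (2 * e * assignment_value I \<phi>)"
      using satisfied_pairs_ge[OF I \<psi>q \<phi>(1) sat \<rho>] pairs_eq[of \<phi>, OF \<phi>(2)] e by simp
    also have "\<dots> \<le> 16 * real ?k * (real ?n ^ 2 * assignment_value I \<phi>)"
      using e_le value_nonneg by (intro mult_left_mono mult_right_mono) auto
    also have "\<dots> = 16 * real ?k * assignment_value I \<phi> * real ?n ^ 2" by (simp only: mult_ac)
    finally have main': "\<rho> ^ (d + 2) * real ?q powr (- (1 / real ?k)) \<le> 16 * real ?k * assignment_value I \<phi>"
      by (rule mult_right_le_imp_le) (use n in simp)
    have k\<gamma>: "1 / \<gamma> \<le> real ?k" "real ?k < 1 / \<gamma> + 1"
    proof -
      have "real ?k = of_int \<lceil>1 / \<gamma>\<rceil>" using \<gamma> unfolding d by simp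
      then show "1 / \<gamma> \<le> real ?k" "real ?k < 1 / \<gamma> + 1" using ceiling_correct[of "1 / \<gamma>"] by linarith+
    qed
    show ?thesis
    proof (cases "\<gamma> \<le> 2")
      case True
      \<comment> \<open>The exponent is k + 1 from the search plus k to pay for the factor 1/k. With
        k < 1/\<gamma> + 1 the sum 2k + 1 is below 2/\<gamma> + 3, and 3 \<le> 6/\<gamma> because
        \<gamma> \<le> 2; this is the origin of the 8.\<close>
      have "\<rho> powr (8 / \<gamma>) \<le> \<rho> powr (real (d + 2 + ?k))"
      proof (rule powr_mono')
        have "3 \<le> 6 / \<gamma>" using True \<gamma> by (simp add: field_simps)
        then show "real (d + 2 + ?k) \<le> 8 / \<gamma>" using k\<gamma>(2) by simp
      qed (use \<rho> \<rho>_le in auto)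
      also have "\<dots> = \<rho> ^ (d + 2 + ?k)" using \<rho> by (rule powr_realpow)
      also have "\<dots> = \<rho> ^ (d + 2) * \<rho> ^ ?k" by (rule power_add)
      also have "\<dots> \<le> \<rho> ^ (d + 2) * (1 / real ?k)"
      proof (rule mult_left_mono)
        have "real ?k \<le> 2 ^ ?k" using of_nat_less_two_power[of ?k, where 'a = real] by linarith
        then have "real ?k * \<rho> ^ ?k \<le> 2 ^ ?k * \<rho> ^ ?k" using \<rho> by (intro mult_right_mono) auto
        also have "\<dots> = (2 * \<rho>) ^ ?k" by (rule power_mult_distrib[symmetric])
        also have "\<dots> \<le> 1" using \<rho> \<rho>_le by (intro power_le_one) auto
        finally show "\<rho> ^ ?k \<le> 1 / real ?k" by (simp add: field_simps)
      qed (use \<rho> in simp)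
      finally have 1: "\<rho> powr (8 / \<gamma>) \<le> \<rho> ^ (d + 2) * (1 / real ?k)" .
      have "1 / real ?k \<le> \<gamma>" using k\<gamma>(1) \<gamma> by (simp add: field_simps)
      then have "N powr (- \<gamma>) \<le> N powr (- (1 / real ?k))" using N by (intro powr_mono) auto
      also have "\<dots> \<le> real ?q powr (- (1 / real ?k))"
        using N q by (intro powr_mono2') auto
      finally have 2: "N powr (- \<gamma>) \<le> real ?q powr (- (1 / real ?k))" .
      have "\<rho> powr (8 / \<gamma>) * N powr (- \<gamma>) \<le> \<rho> ^ (d + 2) * (1 / real ?k) * real ?q powr (- (1 / real ?k))"
        using 1 2 \<rho> by (intro mult_mono) auto
      also have "\<dots> \<le> 16 * assignment_value I \<phi>" using main' by (simp add: field_simps)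
      finally show ?thesis unfolding \<rho>_def N_def by simp
    next
      case False
      \<comment> \<open>Now \<open>main\<close> serves only to show that some edge is satisfied.
        Then the value is at least \<open>1 / e\<close>, hence at least \<open>N powr (- 2)\<close>,
        which exceeds the target as \<gamma> > 2.\<close>
      have "0 < \<rho> ^ (d + 2) * real ?q powr (- (1 / real ?k)) * real ?n ^ 2" using \<rho> q n by simp
      then have "assignment_value I \<phi> \<noteq> 0" using main by (auto simp only: mult_zero_right)
      then have "0 < assignment_value I \<phi>" using value_nonneg[of \<phi>] by simp
      then have "1 \<le> e * assignment_value I \<phi>"
        using e unfolding assignment_value_def e_def by (simp add: zero_less_divide_iff Suc_le_eq)
      also have "\<dots> \<le> real ?n ^ 2 * assignment_value I \<phi>"
        using e_le e value_nonneg by (intro mult_right_mono) auto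
      also have "\<dots> \<le> N ^ 2 * assignment_value I \<phi>"
        using N value_nonneg by (intro mult_right_mono power_mono) auto
      finally have 1: "1 / N ^ 2 \<le> assignment_value I \<phi>" using N by (simp add: field_simps)
      have "N powr (- \<gamma>) \<le> N powr (- 2)" using N False by (intro powr_mono) auto
      also have "\<dots> = 1 / N ^ 2" using N by (simp add: powr_minus divide_simps)
      finally have "N powr (- \<gamma>) \<le> assignment_value I \<phi>" using 1 by simp
      moreover have "\<rho> powr (8 / \<gamma>) * N powr (- \<gamma>) \<le> 1 * N powr (- \<gamma>)"
        using \<rho> \<rho>_le \<gamma> by (intro mult_right_mono powr_le1) auto
      ultimately show ?thesis unfolding \<rho>_def[symmetric] N_def[symmetric]
        using value_nonneg[of \<phi>] by simp
    qed
  qed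
qed

theorem mainTheorem1:
  "\<exists>K c :: real. K > 0 \<and> c > 0 \<and>
    (\<forall>\<gamma> :: real. \<gamma> > 0 \<longrightarrow>
      (\<exists>alg :: com.
        polynomial_time_on (encode_csp ` {I. max_2csp I}) alg \<and>
        (\<forall>(I :: csp) (\<delta> :: real) (val :: real).
          max_2csp I \<longrightarrow> density I = \<delta> \<longrightarrow> csp_value I = val \<longrightarrow>
          (\<exists>\<phi>. produces alg I \<phi> \<and>
            assignment_value I \<phi> \<ge>
              c * ((\<delta> * val) powr (K / \<gamma>) * real (num_vertices I * alphabet I) powr (- \<gamma>))))))"
proof (rule exI[of _ 8], rule exI[of _ "1 / 16"], intro conjI allI impI)
  fix \<gamma> :: real assume \<gamma>: "\<gamma> > 0"
  then have "0 < nat \<lceil>1 / \<gamma>\<rceil>" by simp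
  \<comment> \<open>One node fewer than k is guessed: the tuple found in
    \<open>satisfied_pairs_ge\<close> has length less than k, the last step being the one that keeps
    a large fraction.\<close>
  then obtain d where d: "Suc d = nat \<lceil>1 / \<gamma>\<rceil>" using gr0_conv_Suc by auto
  obtain alg m k where alg: "\<And>I s. s 0 = encode_csp I \<Longrightarrow>
    \<exists>t s'. exec alg s t s' \<and> s' 0 = encode_list encode_nat (solve d I) \<and> (\<forall>j\<ge>m. s' j = s j) \<and>
      t \<le> (size (encode_csp I) + 2) ^ k"
    using ptime_solve[of d] by (rule ptimeE) blast
  have run: "\<exists>t. computes alg (encode_csp I) t (encode_list encode_nat (solve d I)) \<and>
      t \<le> (size (encode_csp I) + 2) ^ k" for I
    using alg[of "(\<lambda>_. Leaf)(0 := encode_csp I)" I] unfolding computes_def by auto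
  show "\<exists>alg. polynomial_time_on (encode_csp ` {I. max_2csp I}) alg \<and>
      (\<forall>I \<delta> val. max_2csp I \<longrightarrow> density I = \<delta> \<longrightarrow> csp_value I = val \<longrightarrow>
        (\<exists>\<phi>. produces alg I \<phi> \<and> assignment_value I \<phi> \<ge>
          1 / 16 * ((\<delta> * val) powr (8 / \<gamma>) * real (num_vertices I * alphabet I) powr (- \<gamma>))))"
  proof (intro exI[of _ alg] conjI allI impI)
    have "poly ([:2, 1:] ^ k) n = (n + 2) ^ k" for n :: nat by (simp add: poly_power add.commute)
    then show "polynomial_time_on (encode_csp ` {I. max_2csp I}) alg"
      unfolding polynomial_time_on_def using run by (intro exI[of _ "[:2, 1:] ^ k"]) fastforce
  next
    fix I and \<delta> val :: real
    assume I: "max_2csp I" and \<delta>: "density I = \<delta>" and val: "csp_value I = val"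
    obtain \<phi> where \<phi>: "\<And>v. \<phi> v < alphabet I" "search d I (full_family I) = solution_family I \<phi>"
      using search_solution[OF I] by blast
    \<comment> \<open>Members of \<open>assignments\<close> are extensional, so \<phi> is cut off
      outside the vertex set; neither the encoding nor the value sees the difference.\<close>
    define \<chi> where "\<chi> = restrict \<phi> {..<num_vertices I}"
    have "solve d I = map \<phi> [0..<num_vertices I]"
      by (simp add: solve_def \<phi>(2) solution_family_def fam_def first_label_def)
    moreover have "encode_list encode_nat (map \<phi> xs) = encode_list (\<lambda>v. encode_nat (\<chi> v)) xs"
      if "set xs \<subseteq> {..<num_vertices I}" for xs
      using that by (induction xs) (auto simp: \<chi>_def)
    from this[of "[0..<num_vertices I]"]
    have "encode_list encode_nat (map \<phi> [0..<num_vertices I]) = encode_assignment I \<chi>"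
      by (simp add: encode_assignment_def atLeast0LessThan)
    ultimately have "encode_list encode_nat (solve d I) = encode_assignment I \<chi>" by simp
    moreover have "\<chi> \<in> assignments I" using \<phi>(1) by (auto simp: assignments_def \<chi>_def)
    ultimately have "produces alg I \<chi>" unfolding produces_def using run[of I] by auto
    moreover have "assignment_value I \<chi> = assignment_value I \<phi>"
    proof -
      have "{(u, v) \<in> edges I. constraint I (u, v) (\<chi> u) (\<chi> v)} =
          {(u, v) \<in> edges I. constraint I (u, v) (\<phi> u) (\<phi> v)}"
        using max_2csp_edge(1,2)[OF I] by (auto simp: \<chi>_def)
      then show ?thesis by (simp add: assignment_value_def)
    qed
    ultimately show "\<exists>\<phi>. produces alg I \<phi> \<and> assignment_value I \<phi> \<ge>
        1 / 16 * ((\<delta> * val) powr (8 / \<gamma>) * real (num_vertices I * alphabet I) powr (- \<gamma>))"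
      using assignment_value_solve_ge[OF I \<gamma> d \<phi>(2,1)] \<delta> val by auto
  qed
qed simp_all

end
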